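(* Let $f\in H$ and let $\lambda\in\rho(A)$ with $\Re\lambda\ge a_1$. Then for every $x\in N$ (identifying $R(\lambda,A)f\in D(A)$ with its continuous representative), $$[R(\lambda,A)f](x)=\int_N K(x,x',\lambda)f(x')\,dx'.$$
   Context: Fix an integer $n\ge 2$, constants $c_1,\dots,c_n>0$ and $0\le a_1\le a_2\le\dots\le a_n<\infty$. Let $N_1,\dots,N_n$ be $n$ disjoint copies of $(0,\infty)$ and let $N$ be the star-shaped network obtained from $\overline{N_1},\dots,\overline{N_n}$ by identifying their endpoints $0$. A function $f$ on $N$ is identified with the $n$-tuple $(f_1,\dots,f_n)$ of its restrictions to the $N_k$, and $\int_N g\,dx:=\sum_k\int_{N_k}g_k\,dx$. $H=\prod_{k=1}^nL^2(N_k)$ with $(u,v)_H=\sum_k\int_0^\infty u_k\overline{v_k}$. $A$ is defined by $D(A)=\{u\in\prod_kH^2(N_k): u_i(0)=u_k(0)\ \forall i,k,\ \sum_kc_ku_k'(0^+)=0\}$, $Au=(-c_ku_k''+a_ku_k)_k$; $R(\lambda,A)=(\lambda I-A)^{-1}$. Complex square root: $\sqrt{re^{i\phi}}=\sqrt r e^{i\phi/2}$, $r\ge0$, $\phi\in[-\pi,\pi)$. For $\lambda\in\mathbb C$: $\xi_k(\lambda)=\sqrt{(\lambda-a_k)/c_k}$, $s_k(\lambda)=-\sum_{l\ne k}c_l\xi_l(\lambda)/(c_k\xi_k(\lambda))$. For $j\in\{1,\dots,n\}$, $F^{\pm,j}_\lambda:N\to\mathbb C$ is given for $x\in\overline{N_k}$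 by $F^{\pm,j}_\lambda(x)=\cos(\xi_j(\lambda)x)\pm is_j(\lambda)\sin(\xi_j(\lambda)x)$ if $k=j$ and $F^{\pm,j}_\lambda(x)=\exp(\pm i\xi_k(\lambda)x)$ if $k\ne j$. Let $w(\lambda)=i\sum_jc_j\xi_j(\lambda)$ if $\Im\lambda>0$ and $w(\lambda)=-i\sum_jc_j\xi_j(\lambda)$ if $\Im\lambda\le0$. For $\lambda$ with $w(\lambda)\ne0$, $x\in\overline{N_j}$ and $x'\in N$, define (choosing the sign $+$ if $\Im\lambda>0$ and $-$ if $\Im\lambda\le0$ throughout, and reading the index $j+1$ modulo $n$, i.e. $n+1:=1$) $K(x,x',\lambda)=\frac1{w(\lambda)}F^{\pm,j}_\lambda(x)F^{\pm,j+1}_\lambda(x')$ if $x'\in\overline{N_j}$, $x'>x$; and $K(x,x',\lambda)=\frac1{w(\lambda)}F^{\pm,j+1}_\lambda(x)F^{\pm,j}_\lambda(x')$ if $x'\in\overline{N_k}$ with $k\ne j$, or $x'\in\overline{N_j}$ with $x'<x$. *)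

theory Defs
  imports "HOL-Analysis.Analysis"
begin

(* Branches N_1..N_n are indexed by k \<in> {1..n}; a function on N is u :: nat \<Rightarrow> real \<Rightarrow> complex,
   u k t = value on the closed branch \<overline>{N_k} at distance t \<ge> 0 from the vertex. *)

definition L2 :: "(real \<Rightarrow> complex) \<Rightarrow> bool" where
  "L2 g \<longleftrightarrow> set_borel_measurable lborel {0<..} g
             \<and> set_integrable lborel {0<..} (\<lambda>x. (norm (g x))^2)"

definition inH :: "nat \<Rightarrow> (nat \<Rightarrow> real \<Rightarrow> complex) \<Rightarrow> bool" where
  "inH n f \<longleftrightarrow> (\<forall>k\<in>{1..n}. L2 (f k))"

definition normH :: "nat \<Rightarrow> (nat \<Rightarrow> real \<Rightarrow> complex) \<Rightarrow> real" where
  "normH n u = sqrt (\<Sum>k=1..n. LINT x:{0<..}|lborel. (norm (u k x))^2)"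

definition test_fun :: "(real \<Rightarrow> real) \<Rightarrow> bool" where
  "test_fun \<phi> \<longleftrightarrow> (\<forall>m x. (deriv ^^ m) \<phi> differentiable (at x))
      \<and> (\<exists>p q. 0 < p \<and> p < q \<and> (\<forall>x. x \<notin> {p..q} \<longrightarrow> \<phi> x = 0))"

definition is_weak_deriv :: "(real \<Rightarrow> complex) \<Rightarrow> (real \<Rightarrow> complex) \<Rightarrow> bool" where
  "is_weak_deriv g h \<longleftrightarrow> (\<forall>\<phi>. test_fun \<phi> \<longrightarrow>
      (LINT x:{0<..}|lborel. g x * of_real (deriv \<phi> x))
      = - (LINT x:{0<..}|lborel. h x * of_real (\<phi> x)))"

text \<open>resolvent_eq n c a lam u f: u \<in> D(A) (u_k the continuous representatives, of class H^2 on
  each branch, with d k the continuous representative of u_k' and e k = u_k''), and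
  (lam I - A) u = f.\<close>
definition resolvent_eq ::
  "nat \<Rightarrow> (nat \<Rightarrow> real) \<Rightarrow> (nat \<Rightarrow> real) \<Rightarrow> complex \<Rightarrow> (nat \<Rightarrow> real \<Rightarrow> complex)
     \<Rightarrow> (nat \<Rightarrow> real \<Rightarrow> complex) \<Rightarrow> bool" where
  "resolvent_eq n c a lam u f \<longleftrightarrow>
     (\<exists>d e. (\<forall>k\<in>{1..n}.
                 L2 (u k) \<and> continuous_on {0..} (u k)
               \<and> L2 (d k) \<and> continuous_on {0..} (d k) \<and> is_weak_deriv (u k) (d k)
               \<and> L2 (e k) \<and> is_weak_deriv (d k) (e k)
               \<and> (AE x in lborel. x > 0 \<longrightarrow>
                    lam * u k x - (- of_real (c k) * e k x + of_real (a k) * u k x) = f k x))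
          \<and> (\<forall>i\<in>{1..n}. \<forall>k\<in>{1..n}. u i 0 = u k 0)
          \<and> (\<Sum>k=1..n. of_real (c k) * d k 0) = 0)"

definition resolvent_set ::
  "nat \<Rightarrow> (nat \<Rightarrow> real) \<Rightarrow> (nat \<Rightarrow> real) \<Rightarrow> complex set" where
  "resolvent_set n c a = {lam.
      (\<forall>f. inH n f \<longrightarrow> (\<exists>u. resolvent_eq n c a lam u f))
    \<and> (\<forall>f u v. resolvent_eq n c a lam u f \<and> resolvent_eq n c a lam v f \<longrightarrow>
          (\<forall>k\<in>{1..n}. AE x in lborel. x > 0 \<longrightarrow> u k x = v k x))
    \<and> (\<exists>C. \<forall>f u. inH n f \<and> resolvent_eq n c a lam u f \<longrightarrow> normH n u \<le> C * normH n f)}"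

text \<open>Square root with the paper's branch: sqrt(r e^{i\<phi>}) = sqrt r e^{i\<phi>/2}, \<phi> \<in> [-\<pi>,\<pi>).\<close>
definition psqrt :: "complex \<Rightarrow> complex" where
  "psqrt z = of_real (sqrt (cmod z)) *
      exp (\<i> * of_real ((if Arg z = pi then - pi else Arg z) / 2))"

definition xi :: "(nat \<Rightarrow> real) \<Rightarrow> (nat \<Rightarrow> real) \<Rightarrow> nat \<Rightarrow> complex \<Rightarrow> complex" where
  "xi c a k lam = psqrt ((lam - of_real (a k)) / of_real (c k))"

definition s_fun :: "nat \<Rightarrow> (nat \<Rightarrow> real) \<Rightarrow> (nat \<Rightarrow> real) \<Rightarrow> nat \<Rightarrow> complex \<Rightarrow> complex" where
  "s_fun n c a k lam = - (\<Sum>l\<in>{1..n}-{k}. of_real (c l) * xi c a l lam)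
                         / (of_real (c k) * xi c a k lam)"

definition sgn_lam :: "complex \<Rightarrow> complex" where
  "sgn_lam lam = (if Im lam > 0 then 1 else -1)"

definition F_fun :: "nat \<Rightarrow> (nat \<Rightarrow> real) \<Rightarrow> (nat \<Rightarrow> real) \<Rightarrow> nat \<Rightarrow> complex \<Rightarrow> nat \<Rightarrow> real \<Rightarrow> complex" where
  "F_fun n c a j lam k t =
     (if k = j then cos (xi c a j lam * of_real t)
                    + sgn_lam lam * \<i> * s_fun n c a j lam * sin (xi c a j lam * of_real t)
      else exp (sgn_lam lam * \<i> * xi c a k lam * of_real t))"

definition w_fun :: "nat \<Rightarrow> (nat \<Rightarrow> real) \<Rightarrow> (nat \<Rightarrow> real) \<Rightarrow> complex \<Rightarrow> complex" where
  "w_fun n c a lam = sgn_lam lam * \<i> * (\<Sum>j=1..n. of_real (c j) * xi c a j lam)"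

definition nxt :: "nat \<Rightarrow> nat \<Rightarrow> nat" where
  "nxt n j = (if j = n then 1 else j + 1)"

text \<open>K(x,x',lam) for x at distance t on closed branch j, x' at distance t' on closed branch k.
  (The diagonal x' = x, a null set, is assigned the second formula.)\<close>
definition K_fun :: "nat \<Rightarrow> (nat \<Rightarrow> real) \<Rightarrow> (nat \<Rightarrow> real) \<Rightarrow> nat \<Rightarrow> real \<Rightarrow> nat \<Rightarrow> real \<Rightarrow> complex \<Rightarrow> complex" where
  "K_fun n c a j t k t' lam =
     (if k = j \<and> t' > t
      then F_fun n c a j lam j t * F_fun n c a (nxt n j) lam k t' / w_fun n c a lam
      else F_fun n c a (nxt n j) lam j t * F_fun n c a j lam k t' / w_fun n c a lam)"

end

theory Submission
  imports Defs "HOL-Probability.Sinc_Integral"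
begin

text \<open>A real \<open>\<lambda> \<ge> a\<^sub>1\<close> lies in the spectrum, because a Weyl sequence on the first branch violates the
  resolvent bound; hence \<open>\<lambda>\<close> is not real. Then \<open>\<kappa>\<^sub>k = \<plusminus>\<i>\<xi>\<^sub>k\<close> has negative real part,
  \<open>c\<^sub>k \<kappa>\<^sub>k\<^sup>2 = a\<^sub>k - \<lambda>\<close> and \<open>w = \<Sum>\<^sub>k c\<^sub>k \<kappa>\<^sub>k \<noteq> 0\<close>. Let \<open>u\<close> solve \<open>(\<lambda> - A) u = f\<close>. On each branch,
  \<open>exp (\<kappa>x) f = (c exp (\<kappa>x) (u' - \<kappa>u))'\<close> for both roots \<open>\<kappa> = \<plusminus>\<kappa>\<^sub>k\<close>, so the integrals occurring in
  \<open>\<integral> K(x, x') f(x') dx'\<close> are boundary terms at the vertex, at \<open>x\<close> and at infinity. Those at infinity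
  vanish by square integrability, those at the vertex cancel by continuity and the Kirchhoff
  condition, and those at \<open>x\<close> add up to \<open>u(x)\<close>.\<close>

section \<open>Smooth step functions\<close>

text \<open>The derivatives of \<open>u\<close> are given only weakly, against smooth functions
  whose support stays away from the vertex, yet the argument needs boundary terms at the vertex
  itself. The fundamental theorem of calculus for weak derivatives is therefore extracted from the
  definition, which takes explicit smooth cutoffs whose transition layers shrink to the endpoints
  from the right.

  The constant s_j has two meanings. All branches of F^j equal 1 at the vertex, and the outgoing
  derivative of F^j there is \<kappa>_j s_j on branch j and \<kappa>_k on the others; s_j makes
  their sum weighted by c_k vanish, so F^j meets both vertex conditions, at the price of a growing
  exponential with coefficient (1 - s_j)/2 on branch j. The same choice gives c_j \<kappa>_j (1 -
  s_j) = w, which is why 1/w normalises the kernel. The growing exponential is only ever integrated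
  up to x; beyond x the kernel uses F^(j+1), which decays on branch j.

  For real \<lambda> \<ge> a_1 both roots \<plusminus>\<kappa>_1 are purely imaginary and no
  decaying exponential exists on the first branch; this is the obstacle that the Weyl functions
  remove.\<close>

primrec n_times_diff :: "nat \<Rightarrow> (real \<Rightarrow> real) \<Rightarrow> bool" where
  "n_times_diff 0 f \<longleftrightarrow> True"
| "n_times_diff (Suc m) f \<longleftrightarrow> (\<exists>g. (\<forall>x. (f has_real_derivative g x) (at x)) \<and> n_times_diff m g)"

lemma n_times_diff_SucD: "n_times_diff (Suc m) f \<Longrightarrow> n_times_diff m f"
  by (induction m arbitrary: f) (simp, metis n_times_diff.simps(2))

text \<open>The closure rules below are inductions that carry a derivative as witness, which is
  awkward with iterated \<open>deriv\<close>; this equivalence brings their results back to the form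
  that \<open>test_fun\<close> demands.\<close>

lemma smooth_iff_n_times_diff: "(\<forall>m x. (deriv ^^ m) f differentiable (at x)) \<longleftrightarrow> (\<forall>m. n_times_diff m f)"
proof -
  have "(\<forall>j<m. \<forall>x. (deriv ^^ j) f differentiable (at x)) \<longleftrightarrow> n_times_diff m f" for m
  proof (induction m arbitrary: f)
    case (Suc m)
    have "(\<forall>j<Suc m. \<forall>x. (deriv ^^ j) f differentiable (at x)) \<longleftrightarrow>
        (\<forall>x. f differentiable (at x)) \<and> (\<forall>j<m. \<forall>x. (deriv ^^ j) (deriv f) differentiable (at x))"
      by (simp add: All_less_Suc2 funpow_Suc_right del: funpow.simps(2))
    also have "\<dots> \<longleftrightarrow> (\<forall>x. f differentiable (at x)) \<and> n_times_diff m (deriv f)"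
      by (simp only: Suc)
    also have "\<dots> \<longleftrightarrow> n_times_diff (Suc m) f"
    proof
      assume *: "(\<forall>x. f differentiable (at x)) \<and> n_times_diff m (deriv f)"
      then have "\<forall>x. (f has_real_derivative deriv f x) (at x)"
        by (metis DERIV_imp_deriv real_differentiable_def)
      with * show "n_times_diff (Suc m) f" by auto
    next
      assume "n_times_diff (Suc m) f"
      then obtain g where g: "\<forall>x. (f has_real_derivative g x) (at x)" "n_times_diff m g" by auto
      then have "deriv f = g" by (auto intro: DERIV_imp_deriv)
      with g show "(\<forall>x. f differentiable (at x)) \<and> n_times_diff m (deriv f)"
        by (auto simp: real_differentiable_def)
    qed
    finally show ?case .
  qed simp
  then show ?thesis by (metis lessI)
qed

lemma n_times_diff_add: "n_times_diff m f \<Longrightarrow> n_times_diff m g \<Longrightarrow> n_times_diff m (\<lambda>x. f x + g x)"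
proof (induction m arbitrary: f g)
  case (Suc m)
  then obtain f' g' where "\<forall>x. (f has_real_derivative f' x) (at x)" "n_times_diff m f'"
    "\<forall>x. (g has_real_derivative g' x) (at x)" "n_times_diff m g'" by auto
  then show ?case
    using Suc.IH[of f' g'] by (auto intro!: exI[of _ "\<lambda>x. f' x + g' x"] derivative_eq_intros)
qed simp

lemma n_times_diff_const: "n_times_diff m (\<lambda>x. k)"
  by (induction m arbitrary: k) (auto intro!: exI[of _ "\<lambda>x. 0"])

lemma n_times_diff_mult: "n_times_diff m f \<Longrightarrow> n_times_diff m g \<Longrightarrow> n_times_diff m (\<lambda>x. f x * g x)"
proof (induction m arbitrary: f g)
  case (Suc m)
  then obtain f' g' where fg: "\<forall>x. (f has_real_derivative f' x) (at x)" "n_times_diff m f'"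
    "\<forall>x. (g has_real_derivative g' x) (at x)" "n_times_diff m g'" by auto
  have 1: "n_times_diff m (\<lambda>x. f' x * g x + f x * g' x)"
    using fg Suc.prems[THEN n_times_diff_SucD] by (intro n_times_diff_add Suc.IH)
  have 2: "((\<lambda>x. f x * g x) has_real_derivative f' x * g x + f x * g' x) (at x)" for x
    using DERIV_mult[OF fg(1)[rule_format] fg(3)[rule_format]] by (simp add: algebra_simps)
  show ?case
    unfolding n_times_diff.simps by (intro exI[of _ "\<lambda>x. f' x * g x + f x * g' x"] conjI allI 1 2)
qed simp

lemma n_times_diff_affine: "n_times_diff m f \<Longrightarrow> n_times_diff m (\<lambda>x. f (r * x + s))"
proof (induction m arbitrary: f)
  case (Suc m)
  then obtain f' where f': "\<forall>x. (f has_real_derivative f' x) (at x)" "n_times_diff m f'" by auto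
  then have "n_times_diff m (\<lambda>x. r * f' (r * x + s))"
    using Suc.IH n_times_diff_mult n_times_diff_const by blast
  moreover have "((\<lambda>x. f (r * x + s)) has_real_derivative r * f' (r * x + s)) (at x)" for x
  proof -
    have "((\<lambda>x. r * x + s) has_real_derivative r) (at x)"
      by (auto intro!: derivative_eq_intros)
    with f' have "((\<lambda>x. f (r * x + s)) has_real_derivative f' (r * x + s) * r) (at x)"
      by (intro DERIV_chain2[of f]) auto
    then show ?thesis by (simp add: mult.commute)
  qed
  ultimately show ?case by (auto intro!: exI[of _ "\<lambda>x. r * f' (r * x + s)"])
qed simp

text \<open>With r + \<i>s = \<kappa>, the pairs (p, q) = (1, 0) and (0, 1) give the real and
  imaginary parts of exp(\<kappa>x). Both coefficients stay free because differentiation mixes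
  them.\<close>

lemma n_times_diff_exp_trig:
  "n_times_diff m (\<lambda>x. exp (r * x) * (p * cos (s * x) + q * sin (s * x)))"
proof (induction m arbitrary: p q)
  case (Suc m)
  have "((\<lambda>x. exp (r * x) * (p * cos (s * x) + q * sin (s * x))) has_real_derivative
      exp (r * x) * ((r * p + s * q) * cos (s * x) + (r * q - s * p) * sin (s * x))) (at x)" for x
    by (auto intro!: derivative_eq_intros simp: algebra_simps)
  then show ?case
    using Suc by (auto intro!: exI[of _ "\<lambda>x. exp (r * x) * ((r * p + s * q) * cos (s * x) + (r * q - s * p) * sin (s * x))"])
qed simp

section \<open>Flat functions at 0 and the smooth step\<close>

definition flat_exp :: "real poly \<Rightarrow> real \<Rightarrow> real" where
  "flat_exp P x = (if x > 0 then poly P (1 / x) * exp (- (1 / x)) else 0)"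

lemma poly_times_exp_minus_tendsto_0: "((\<lambda>x::real. poly P x * exp (- x)) \<longlongrightarrow> 0) at_top"
proof -
  have "((\<lambda>x. \<Sum>i\<le>degree P. coeff P i * (x ^ i / exp x)) \<longlongrightarrow> (\<Sum>i\<le>degree P. coeff P i * 0)) at_top"
    by (intro tendsto_intros tendsto_power_div_exp_0)
  also have "(\<lambda>x. \<Sum>i\<le>degree P. coeff P i * (x ^ i / exp x)) = (\<lambda>x. poly P x * exp (- x))"
    by (simp add: fun_eq_iff poly_altdef exp_minus divide_inverse sum_distrib_right mult.assoc)
  finally show ?thesis by simp
qed

text \<open>With y = 1/x one has dy/dx = -y^2, so P(y) exp(-y) has derivative y^2 (P(y) - P'(y))
  exp(-y). The family is closed under differentiation, hence smooth.\<close>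

lemma flat_exp_has_derivative:
  "(flat_exp P has_real_derivative flat_exp ([:0, 0, 1:] * (P - pderiv P)) x) (at x)"
proof -
  consider "x > 0" | "x < 0" | "x = 0" by linarith
  then show ?thesis
  proof cases
    case 1
    have "((\<lambda>x. poly P (1 / x) * exp (- (1 / x))) has_real_derivative
        flat_exp ([:0, 0, 1:] * (P - pderiv P)) x) (at x)"
      using 1 by (auto intro!: derivative_eq_intros DERIV_chain2[OF poly_DERIV]
         simp: flat_exp_def field_simps power2_eq_square)
    then show ?thesis
      by (rule has_field_derivative_transform_within_open[of _ _ _ "{0<..}"])
         (use 1 in \<open>auto simp: flat_exp_def\<close>)
  next
    case 2
    have "((\<lambda>x. 0) has_real_derivative flat_exp ([:0, 0, 1:] * (P - pderiv P)) x) (at x)"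
      using 2 by (simp add: flat_exp_def)
    then show ?thesis
      by (rule has_field_derivative_transform_within_open[of _ _ _ "{..<0}"])
         (use 2 in \<open>auto simp: flat_exp_def\<close>)
  next
    case 3
    \<comment> \<open>The difference quotient at 0 divides by h, that is, it multiplies by y = 1/h;
      on the polynomial this is \<open>pCons 0\<close>.\<close>
    have "((\<lambda>h. poly (pCons 0 P) (inverse h) * exp (- inverse h)) \<longlongrightarrow> 0) (at_right (0::real))"
      by (rule filterlim_compose[OF poly_times_exp_minus_tendsto_0 filterlim_inverse_at_top_right])
    then have R: "((\<lambda>h. flat_exp P h / h) \<longlongrightarrow> 0) (at_right 0)"
      by (rule Lim_transform_eventually)
        (auto simp: flat_exp_def eventually_at_right_less field_simps intro!: eventually_mono[OF eventually_at_right_less])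
    have "((\<lambda>h::real. 0) \<longlongrightarrow> (0::real)) (at_left 0)" by simp
    then have "((\<lambda>h. flat_exp P h / h) \<longlongrightarrow> 0) (at_left 0)"
      by (rule Lim_transform_eventually)
        (auto simp: flat_exp_def eventually_at_filter)
    with R have "((\<lambda>h. flat_exp P h / h) \<longlongrightarrow> 0) (at 0)"
      by (simp add: filterlim_at_split)
    then show ?thesis
      using 3 by (simp add: has_field_derivative_iff flat_exp_def)
  qed
qed

lemma n_times_diff_flat_exp: "n_times_diff m (flat_exp P)"
  by (induction m arbitrary: P) (simp, use flat_exp_has_derivative in auto)

lemma smooth_step_exists:
  obtains S B :: "real \<Rightarrow> real"
  where "\<And>m. n_times_diff m S" "\<And>x. (S has_real_derivative B x) (at x)" "continuous_on UNIV B" "\<And>x. 0 \<le> B x"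
    "\<And>x. x \<notin> {0..1} \<Longrightarrow> B x = 0" "\<And>x. x \<le> 0 \<Longrightarrow> S x = 0" "\<And>x. x \<ge> 1 \<Longrightarrow> S x = 1"
    "\<And>x. 0 \<le> S x" "\<And>x. S x \<le> 1"
proof -
  \<comment> \<open>A bump that is positive exactly on the open unit interval;
    \<open>- 1 * x + 1\<close> is spelled to match \<open>n_times_diff_affine\<close>.\<close>
  define b where "b x = flat_exp 1 x * flat_exp 1 (- 1 * x + 1)" for x
  have Cb: "n_times_diff m b" for m
    unfolding b_def by (intro n_times_diff_mult n_times_diff_affine n_times_diff_flat_exp)
  have cb: "continuous_on UNIV b"
    using Cb[of 1] DERIV_continuous_on[of UNIV b] by auto
  have b0: "b x \<ge> 0" for x by (simp add: b_def flat_exp_def)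
  have bz: "b x = 0" if "x \<notin> {0..1}" for x using that by (auto simp: b_def flat_exp_def)
  \<comment> \<open>Starting at -1 instead of 0 puts 0 in the interior of the range of integration,
    so that the derivative there is two-sided.\<close>
  define T where "T = (\<lambda>x. integral {-1..x} b)"
  have dT: "(T has_real_derivative b x) (at x)" if "x > -1" for x
  proof -
    have "((\<lambda>u. integral {-1..u} b) has_real_derivative b x) (at x within {-1..x+1})"
      by (rule integral_has_real_derivative) (use that cb continuous_on_subset in auto)
    then have "((\<lambda>u. integral {-1..u} b) has_real_derivative b x) (at x within {-1<..<x+1})"
      by (rule DERIV_subset) auto
    then show ?thesis
      using that at_within_open[of x "{-1<..<x+1}"] by (simp add: T_def)
  qed
  have T0: "T x = 0" if "x \<le> 0" for x
  proof -
    have "(b has_integral 0) {-1..x}"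
    proof (rule has_integral_is_0)
      fix y assume "y \<in> {-1..x}" then show "b y = 0" using that by (auto simp: b_def flat_exp_def)
    qed
    then show ?thesis by (auto simp: T_def)
  qed
  have T1: "T x = T 1" if "x \<ge> 1" for x
  proof (cases "x = 1")
    case False
    show ?thesis
    proof (rule DERIV_isconst_end[of 1 x T])
      show "continuous_on {1..x} T"
        by (intro continuous_at_imp_continuous_on ballI DERIV_isCont[OF dT]) auto
      show "(T has_real_derivative 0) (at y)" if "1 < y" "y < x" for y
        using dT[of y] bz[of y] that by auto
    qed (use that False in auto)
  qed simp
  have mono: "T x \<le> T y" if "x \<le> y" for x y
  proof (cases "x \<le> 0")
    case True
    have "T y \<ge> 0" unfolding T_def by (rule integral_nonneg) (auto intro!: b0 integrable_continuous_real continuous_on_subset[OF cb])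
    then show ?thesis using T0 True by auto
  next
    case False
    then show ?thesis
      using that by (intro DERIV_nonneg_imp_nondecreasing[of x y T]) (auto intro!: exI[of _ "b _"] dT b0)
  qed
  \<comment> \<open>Otherwise monotonicity squeezes \<open>T\<close> to 0 everywhere, although its
    derivative at 1/2 is positive.\<close>
  have "T 1 \<noteq> 0"
  proof
    assume "T 1 = 0"
    then have "T y = 0" for y using mono[of y 1] mono[of 0 y] T0[of 0] T0[of y] T1[of y] by (cases "y \<le> 1"; cases "0 \<le> y") auto
    then have "((\<lambda>x. 0) has_real_derivative b (1/2)) (at (1/2))"
      using dT[of "1/2"] by (simp add: fun_eq_iff[THEN iffD2] ext[of T "\<lambda>x. 0"])
    then have "b (1/2) = 0" using DERIV_unique DERIV_const by blast
    then show False by (simp add: b_def flat_exp_def)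
  qed
  moreover have "T 1 \<ge> 0" using mono[of 0 1] T0 by auto
  ultimately have Tp: "T 1 > 0" by simp
  define S where "S x = (1 / T 1) * T x" for x
  define B where "B x = (1 / T 1) * b x" for x
  have dS: "(S has_real_derivative B x) (at x)" for x
  proof (cases "x > -1")
    case True
    then show ?thesis unfolding S_def [abs_def] B_def by (intro derivative_intros DERIV_cmult dT)
  next
    case False
    have "((\<lambda>x. 0) has_real_derivative B x) (at x)" using False bz[of x] by (simp add: B_def)
    then show ?thesis
      by (rule has_field_derivative_transform_within_open[of _ _ _ "{..<0}"]) (use False T0 in \<open>auto simp: S_def\<close>)
  qed
  show thesis
  proof (rule that[of S B])
    show "(S has_real_derivative B x) (at x)" for x by (rule dS)
    show "n_times_diff m S" for m
    proof (cases m)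
      case (Suc k)
      have "n_times_diff k B" unfolding B_def by (intro n_times_diff_mult n_times_diff_const Cb)
      then show ?thesis
        unfolding Suc n_times_diff.simps by (intro exI[of _ B] conjI allI dS)
    qed simp
    show "continuous_on UNIV B" unfolding B_def by (intro continuous_intros cb)
    have "0 \<le> T x \<and> T x \<le> T 1" for x
      using mono[of 0 x] mono[of x 1] T0[of x] T0[of 0] T1[of x] Tp by (cases "x \<le> 0"; cases "x \<le> 1") auto
    then show "0 \<le> S x" "S x \<le> 1" for x using Tp by (auto simp: S_def)
    show "0 \<le> B x" for x using Tp b0[of x] by (simp add: B_def)
    show "B x = 0" if "x \<notin> {0..1}" for x using bz[OF that] by (simp add: B_def)
    show "S x = 0" if "x \<le> 0" for x using T0[OF that] by (simp add: S_def)
    show "S x = 1" if "x \<ge> 1" for x using T1[OF that] Tp by (simp add: S_def)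
  qed
qed

section \<open>Square integrable functions and weak derivatives\<close>

text \<open>Integrability reaches up to the vertex, not just over compact parts of the open
  half-line, because \<open>weak_deriv_FTC\<close> must allow p = 0. Unlike \<open>L2\<close>, the
  notion survives multiplication by growing exponentials.\<close>

definition loc_int :: "(real \<Rightarrow> complex) \<Rightarrow> bool" where
  "loc_int g \<longleftrightarrow> (\<forall>q. set_integrable lborel {0<..q} g)"

lemma L2_mult_integrable:
  assumes "L2 g" "L2 h"
  shows "set_integrable lborel {0<..} (\<lambda>x. g x * h x)"
proof -
  have "set_integrable lborel {0<..} (\<lambda>x. (norm (g x))^2 + (norm (h x))^2)"
    using assms by (intro set_integral_add) (auto simp: L2_def)
  then show ?thesis
  proof (rule set_integrable_bound)
    have "(\<lambda>x. (indicator {0<..} x *\<^sub>R g x) * (indicator {0<..} x *\<^sub>R h x)) \<in> borel_measurable lborel"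
      using assms by (intro borel_measurable_times) (simp_all add: L2_def set_borel_measurable_def)
    also have "(\<lambda>x. (indicator {0<..} x *\<^sub>R g x) * (indicator {0<..} x *\<^sub>R h x)) =
        (\<lambda>x. indicator {0<..} x *\<^sub>R (g x * h x))"
      by (auto simp: fun_eq_iff split: split_indicator)
    finally show "set_borel_measurable lborel {0<..} (\<lambda>x. g x * h x)"
      by (simp add: set_borel_measurable_def)
    have "norm (g x * h x) \<le> norm ((norm (g x))^2 + (norm (h x))^2)" for x
    proof -
      have "0 \<le> (norm (g x) - norm (h x))^2" by simp
      moreover have "0 \<le> norm (g x) * norm (h x)" by simp
      ultimately have "norm (g x) * norm (h x) \<le> (norm (g x))^2 + (norm (h x))^2"
        by (simp only: power2_diff)
      then show ?thesis by (simp add: norm_mult)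
    qed
    then show "AE x in lborel. x \<in> {0<..} \<longrightarrow> norm (g x * h x) \<le> norm ((norm (g x))^2 + (norm (h x))^2)"
      by simp
  qed
qed

lemma L2_loc_int:
  assumes "L2 g" shows "loc_int g"
  unfolding loc_int_def
proof
  fix q
  have "set_integrable lborel {0<..q} (\<lambda>x. (norm (g x))^2)"
    using assms by (auto simp: L2_def intro: set_integrable_subset)
  moreover have "set_integrable lborel {0<..q} (\<lambda>x. 1::real)"
    by (auto simp: set_integrable_def intro!: integrable_real_indicator)
      (cases "0 \<le> q", auto)
  ultimately have "set_integrable lborel {0<..q} (\<lambda>x. 1 + (norm (g x))^2)"
    by (intro set_integral_add)
  then show "set_integrable lborel {0<..q} g"
  proof (rule set_integrable_bound)
    show "set_borel_measurable lborel {0<..q} g"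
      using assms by (auto simp: L2_def intro: set_borel_measurable_subset)
    have "norm (g x) \<le> norm (1 + (norm (g x))^2)" for x
    proof -
      have "0 \<le> (norm (g x) - 1)^2" "0 \<le> norm (g x)" by simp_all
      then have "2 * norm (g x) \<le> (norm (g x))^2 + 1" "0 \<le> norm (g x)" by (simp_all add: power2_diff)
      then have "norm (g x) \<le> 1 + (norm (g x))^2" by linarith
      then show ?thesis by simp
    qed
    then show "AE x in lborel. x \<in> {0<..q} \<longrightarrow> norm (g x) \<le> norm (1 + (norm (g x))^2)" by simp
  qed
qed

lemma loc_int_mult_continuous:
  assumes "loc_int g" "continuous_on UNIV b"
  shows "loc_int (\<lambda>x. b x * g x)"
  unfolding loc_int_def
proof
  fix q
  have "bounded (b ` {0..q})"
    using assms(2) by (intro compact_imp_bounded compact_continuous_image) (auto intro: continuous_on_subset)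
  then obtain M where M: "\<And>x. x \<in> {0..q} \<Longrightarrow> norm (b x) \<le> M" "M > 0"
    unfolding bounded_pos by (meson imageI)
  have g: "set_integrable lborel {0<..q} g" using assms by (simp add: loc_int_def)
  then have "set_integrable lborel {0<..q} (\<lambda>x. of_real M * g x)" by auto
  then show "set_integrable lborel {0<..q} (\<lambda>x. b x * g x)"
  proof (rule set_integrable_bound)
    have "(\<lambda>x. indicator {0<..q} x *\<^sub>R (b x * g x)) = (\<lambda>x. b x * (indicator {0<..q} x *\<^sub>R g x))"
      by (auto split: split_indicator)
    moreover have "b \<in> borel_measurable lborel"
      using borel_measurable_continuous_onI[OF assms(2)] by simp
    moreover have "(\<lambda>x. indicator {0<..q} x *\<^sub>R g x) \<in> borel_measurable lborel"
      using g by (simp only: set_integrable_def borel_measurable_integrable)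
    ultimately show "set_borel_measurable lborel {0<..q} (\<lambda>x. b x * g x)"
      unfolding set_borel_measurable_def by (simp only: borel_measurable_times)
    show "AE x in lborel. x \<in> {0<..q} \<longrightarrow> norm (b x * g x) \<le> norm (of_real M * g x)"
    proof (intro AE_I2 impI)
      fix x assume "x \<in> {0<..q}"
      then have "norm (b x) * norm (g x) \<le> M * norm (g x)"
        by (intro mult_right_mono M) auto
      then show "norm (b x * g x) \<le> norm (of_real M * g x)"
        using M(2) by (simp add: norm_mult)
    qed
  qed
qed

lemma loc_int_times_compact_support:
  assumes "loc_int g" "continuous_on UNIV b" "\<And>x. x \<notin> {p..q} \<Longrightarrow> b x = 0"
  shows "set_integrable lborel {0<..} (\<lambda>x. g x * b x)"
proof -
  have "set_integrable lborel {0<..q} (\<lambda>x. b x * g x)"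
    using loc_int_mult_continuous[OF assms(1,2)] by (simp add: loc_int_def)
  moreover have "(\<lambda>x. indicator {0<..} x *\<^sub>R (g x * b x)) = (\<lambda>x. indicator {0<..q} x *\<^sub>R (b x * g x))"
    using assms(3) by (force split: split_indicator)
  ultimately show ?thesis by (simp add: set_integrable_def)
qed

lemma loc_int_times_test:
  assumes "loc_int g" "continuous_on UNIV b" "\<And>x. x \<notin> {p..q} \<Longrightarrow> b x = (0::real)"
  shows "set_integrable lborel {0<..} (\<lambda>x. g x * of_real (b x))"
  by (rule loc_int_times_compact_support[where p = p and q = q])
     (use assms in \<open>auto intro!: continuous_intros\<close>)

section \<open>Test functions and rules for weak derivatives\<close>

lemma test_funD:
  assumes "test_fun \<phi>"
  obtains p q where "0 < p" "p < q" "\<And>x. x \<notin> {p..q} \<Longrightarrow> \<phi> x = 0"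
    "\<And>x. x \<notin> {p..q} \<Longrightarrow> deriv \<phi> x = 0"
    "\<And>x. (\<phi> has_real_derivative deriv \<phi> x) (at x)"
    "continuous_on UNIV \<phi>" "continuous_on UNIV (deriv \<phi>)"
proof -
  obtain p q where pq: "0 < p" "p < q" "\<And>x. x \<notin> {p..q} \<Longrightarrow> \<phi> x = 0"
    using assms by (auto simp: test_fun_def)
  have d: "(deriv ^^ m) \<phi> differentiable (at x)" for m x
    using assms by (auto simp: test_fun_def)
  have d0: "(\<phi> has_real_derivative deriv \<phi> x) (at x)" for x
    using d[of 0 x] by (auto simp: real_differentiable_def dest: DERIV_imp_deriv)
  have "deriv \<phi> x = 0" if "x \<notin> {p..q}" for x
  proof -
    have "((\<lambda>x. 0) has_real_derivative 0) (at x)" by simp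
    then have "(\<phi> has_real_derivative 0) (at x)"
      by (rule has_field_derivative_transform_within_open[of _ _ _ "- {p..q}"])
        (use that pq(3) in \<open>auto intro!: open_Compl\<close>)
    then show ?thesis by (rule DERIV_imp_deriv)
  qed
  moreover have "continuous_on UNIV \<phi>"
    using d0 by (meson DERIV_continuous_on has_field_derivative_at_within)
  moreover have "continuous_on UNIV (deriv \<phi>)"
    using d[of 1] by (auto simp: continuous_on_eq_continuous_at intro: differentiable_imp_continuous_within)
  ultimately show ?thesis by (intro that[OF pq _ d0])
qed

lemma test_fun_mult:
  assumes "\<And>m. n_times_diff m r" "test_fun \<phi>"
  shows "test_fun (\<lambda>x. r x * \<phi> x)"
proof -
  have "n_times_diff m \<phi>" for m
    using assms(2) smooth_iff_n_times_diff[of \<phi>] by (auto simp: test_fun_def)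
  then have "\<forall>m. n_times_diff m (\<lambda>x. r x * \<phi> x)"
    using assms(1) n_times_diff_mult by blast
  then have "\<forall>m x. (deriv ^^ m) (\<lambda>x. r x * \<phi> x) differentiable (at x)"
    using smooth_iff_n_times_diff by blast
  moreover have "\<exists>p q. 0 < p \<and> p < q \<and> (\<forall>x. x \<notin> {p..q} \<longrightarrow> r x * \<phi> x = 0)"
    using assms(2) unfolding test_fun_def by (metis mult_zero_right)
  ultimately show ?thesis unfolding test_fun_def by blast
qed

lemma is_weak_derivD:
  "is_weak_deriv g h \<Longrightarrow> test_fun \<phi> \<Longrightarrow>
    (LINT x:{0<..}|lborel. g x * of_real (deriv \<phi> x)) = - (LINT x:{0<..}|lborel. h x * of_real (\<phi> x))"
  by (simp add: is_weak_deriv_def)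

lemma is_weak_deriv_cmult:
  "is_weak_deriv g h \<Longrightarrow> is_weak_deriv (\<lambda>x. k * g x) (\<lambda>x. k * h x)"
  by (simp add: is_weak_deriv_def mult.assoc)

lemma loc_int_cmult: "loc_int g \<Longrightarrow> loc_int (\<lambda>x. k * g x)"
  by (simp add: loc_int_def)

lemma loc_int_add: "loc_int g \<Longrightarrow> loc_int h \<Longrightarrow> loc_int (\<lambda>x. g x + h x)"
  by (simp add: loc_int_def)

lemma is_weak_deriv_add:
  assumes "is_weak_deriv g1 h1" "is_weak_deriv g2 h2" "loc_int g1" "loc_int g2" "loc_int h1" "loc_int h2"
  shows "is_weak_deriv (\<lambda>x. g1 x + g2 x) (\<lambda>x. h1 x + h2 x)"
  unfolding is_weak_deriv_def
proof (intro allI impI)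
  fix \<phi> assume t: "test_fun \<phi>"
  obtain p q where pq: "0 < p" "p < q" "\<And>x. x \<notin> {p..q} \<Longrightarrow> \<phi> x = 0"
    "\<And>x. x \<notin> {p..q} \<Longrightarrow> deriv \<phi> x = 0"
    "\<And>x. (\<phi> has_real_derivative deriv \<phi> x) (at x)" "continuous_on UNIV \<phi>" "continuous_on UNIV (deriv \<phi>)"
    by (rule test_funD[OF t]) (rule that)
  note I = loc_int_times_test[OF _ pq(6) pq(3)] loc_int_times_test[OF _ pq(7) pq(4)]
  show "(LINT x:{0<..}|lborel. (g1 x + g2 x) * of_real (deriv \<phi> x)) =
      - (LINT x:{0<..}|lborel. (h1 x + h2 x) * of_real (\<phi> x))"
    using is_weak_derivD[OF assms(1) t] is_weak_derivD[OF assms(2) t] I assms(3-)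
    by (simp add: distrib_right set_integral_add)
qed

text \<open>The exponential is moved from g onto the test function. Test functions are real-valued,
  so exp(\<kappa>x)\<phi>(x) is split into the two test functions \<open>\<phi>1\<close> and
  \<open>\<phi>2\<close>, its real and imaginary parts, and the weak derivative of g is used once
  for each.\<close>

lemma is_weak_deriv_exp_mult:
  fixes \<kappa> :: complex
  assumes w: "is_weak_deriv g h" and gi: "loc_int g" and hi: "loc_int h"
  shows "is_weak_deriv (\<lambda>x. exp (\<kappa> * of_real x) * g x)
           (\<lambda>x. exp (\<kappa> * of_real x) * h x + \<kappa> * (exp (\<kappa> * of_real x) * g x))"
  unfolding is_weak_deriv_def
proof (intro allI impI)
  fix \<phi> assume t: "test_fun \<phi>"
  obtain p q where pq: "0 < p" "p < q" "\<And>x. x \<notin> {p..q} \<Longrightarrow> \<phi> x = 0"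
    "\<And>x. x \<notin> {p..q} \<Longrightarrow> deriv \<phi> x = 0"
    "\<And>x. (\<phi> has_real_derivative deriv \<phi> x) (at x)" "continuous_on UNIV \<phi>" "continuous_on UNIV (deriv \<phi>)"
    by (rule test_funD[OF t]) (rule that)
  let ?E = "\<lambda>x. exp (\<kappa> * complex_of_real x)"
  define r s where "r = Re \<kappa>" and "s = Im \<kappa>"
  define \<phi>1 where "\<phi>1 x = exp (r * x) * (1 * cos (s * x) + 0 * sin (s * x)) * \<phi> x" for x
  define \<phi>2 where "\<phi>2 x = exp (r * x) * (0 * cos (s * x) + 1 * sin (s * x)) * \<phi> x" for x
  have t1: "test_fun \<phi>1" and t2: "test_fun \<phi>2"
    unfolding \<phi>1_def \<phi>2_def by (intro test_fun_mult n_times_diff_exp_trig t)+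
  have d1: "deriv \<phi>1 x = exp (r * x) * ((r * cos (s * x) - s * sin (s * x)) * \<phi> x + cos (s * x) * deriv \<phi> x)" for x
    unfolding \<phi>1_def by (rule DERIV_imp_deriv) (auto intro!: derivative_eq_intros pq(5) simp: algebra_simps)
  have d2: "deriv \<phi>2 x = exp (r * x) * ((r * sin (s * x) + s * cos (s * x)) * \<phi> x + sin (s * x) * deriv \<phi> x)" for x
    unfolding \<phi>2_def by (rule DERIV_imp_deriv) (auto intro!: derivative_eq_intros pq(5) simp: algebra_simps)
  have E: "?E x = of_real (exp (r * x)) * (of_real (cos (s * x)) + \<i> * of_real (sin (s * x)))" for x
    by (simp add: r_def s_def complex_eq_iff Re_exp Im_exp)
  have k: "\<kappa> = of_real r + \<i> * of_real s" by (simp add: r_def s_def complex_eq_iff)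
  have c0: "of_real (\<phi>1 x) + \<i> * of_real (\<phi>2 x) = ?E x * of_real (\<phi> x)" for x
    by (simp add: E \<phi>1_def \<phi>2_def algebra_simps)
  have c1: "of_real (deriv \<phi>1 x) + \<i> * of_real (deriv \<phi>2 x) =
      ?E x * of_real (deriv \<phi> x) + \<kappa> * ?E x * of_real (\<phi> x)" for x
    unfolding E d1 d2 by (simp add: k algebra_simps)
  have I: "set_integrable lborel {0<..} (\<lambda>x. v x * of_real (\<psi> x))"
       "set_integrable lborel {0<..} (\<lambda>x. v x * of_real (deriv \<psi> x))"
    if "loc_int v" "test_fun \<psi>" for v \<psi>
    by (rule test_funD[OF that(2)], rule loc_int_times_test[OF that(1)], assumption+)+
  have gE: "loc_int (\<lambda>x. ?E x * g x)" and hE: "loc_int (\<lambda>x. ?E x * h x)"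
    by (intro loc_int_mult_continuous gi hi continuous_intros)+
  have "(LINT x:{0<..}|lborel. ?E x * g x * of_real (deriv \<phi> x)) +
      \<kappa> * (LINT x:{0<..}|lborel. ?E x * g x * of_real (\<phi> x)) =
    (LINT x:{0<..}|lborel. ?E x * g x * of_real (deriv \<phi> x) + \<kappa> * (?E x * g x * of_real (\<phi> x)))"
    using I[OF gE t] by (subst set_integral_add(2)) auto
  also have "\<dots> = (LINT x:{0<..}|lborel. g x * of_real (deriv \<phi>1 x) + \<i> * (g x * of_real (deriv \<phi>2 x)))"
  proof (rule set_lebesgue_integral_cong)
    show "\<forall>x. x \<in> {0<..} \<longrightarrow> ?E x * g x * of_real (deriv \<phi> x) + \<kappa> * (?E x * g x * of_real (\<phi> x)) =
        g x * of_real (deriv \<phi>1 x) + \<i> * (g x * of_real (deriv \<phi>2 x))"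
    proof (intro allI impI)
      fix x
      have "?E x * g x * of_real (deriv \<phi> x) + \<kappa> * (?E x * g x * of_real (\<phi> x)) =
          g x * (?E x * of_real (deriv \<phi> x) + \<kappa> * ?E x * of_real (\<phi> x))"
        by (simp add: algebra_simps)
      also have "\<dots> = g x * of_real (deriv \<phi>1 x) + \<i> * (g x * of_real (deriv \<phi>2 x))"
        unfolding c1[symmetric] by (simp add: algebra_simps)
      finally show "?E x * g x * of_real (deriv \<phi> x) + \<kappa> * (?E x * g x * of_real (\<phi> x)) =
          g x * of_real (deriv \<phi>1 x) + \<i> * (g x * of_real (deriv \<phi>2 x))" .
    qed
  qed simp
  also have "\<dots> = (LINT x:{0<..}|lborel. g x * of_real (deriv \<phi>1 x)) +
      \<i> * (LINT x:{0<..}|lborel. g x * of_real (deriv \<phi>2 x))"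
    using I[OF gi t1] I[OF gi t2] by (subst set_integral_add(2)) auto
  also have "\<dots> = - ((LINT x:{0<..}|lborel. h x * of_real (\<phi>1 x)) +
      \<i> * (LINT x:{0<..}|lborel. h x * of_real (\<phi>2 x)))"
    using is_weak_derivD[OF w t1] is_weak_derivD[OF w t2] by simp
  also have "(LINT x:{0<..}|lborel. h x * of_real (\<phi>1 x)) +
      \<i> * (LINT x:{0<..}|lborel. h x * of_real (\<phi>2 x)) =
      (LINT x:{0<..}|lborel. h x * of_real (\<phi>1 x) + \<i> * (h x * of_real (\<phi>2 x)))"
    using I[OF hi t1] I[OF hi t2] by (subst set_integral_add(2)) auto
  also have "\<dots> = (LINT x:{0<..}|lborel. ?E x * h x * of_real (\<phi> x))"
  proof (rule set_lebesgue_integral_cong)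
    show "\<forall>x. x \<in> {0<..} \<longrightarrow> h x * of_real (\<phi>1 x) + \<i> * (h x * of_real (\<phi>2 x)) = ?E x * h x * of_real (\<phi> x)"
    proof (intro allI impI)
      fix x
      have "h x * of_real (\<phi>1 x) + \<i> * (h x * of_real (\<phi>2 x)) = h x * (of_real (\<phi>1 x) + \<i> * of_real (\<phi>2 x))"
        by (simp add: algebra_simps)
      then show "h x * of_real (\<phi>1 x) + \<i> * (h x * of_real (\<phi>2 x)) = ?E x * h x * of_real (\<phi> x)"
        unfolding c0 by simp
    qed
  qed simp
  finally have "(LINT x:{0<..}|lborel. ?E x * g x * of_real (deriv \<phi> x)) =
      - ((LINT x:{0<..}|lborel. ?E x * h x * of_real (\<phi> x)) + \<kappa> * (LINT x:{0<..}|lborel. ?E x * g x * of_real (\<phi> x)))"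
    by (simp add: algebra_simps add_eq_0_iff)
  also have "(LINT x:{0<..}|lborel. ?E x * h x * of_real (\<phi> x)) + \<kappa> * (LINT x:{0<..}|lborel. ?E x * g x * of_real (\<phi> x))
     = (LINT x:{0<..}|lborel. ?E x * h x * of_real (\<phi> x) + \<kappa> * (?E x * g x * of_real (\<phi> x)))"
    using I[OF gE t] I[OF hE t] by (subst set_integral_add(2)) auto
  finally show "(LINT x:{0<..}|lborel. ?E x * g x * of_real (deriv \<phi> x)) =
      - (LINT x:{0<..}|lborel. (?E x * h x + \<kappa> * (?E x * g x)) * of_real (\<phi> x))"
    by (simp add: distrib_right mult.assoc)
qed

section \<open>The fundamental theorem of calculus for weak derivatives\<close>

lemma approx_identity:
  fixes g :: "real \<Rightarrow> complex" and B :: "real \<Rightarrow> real"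
  assumes B: "continuous_on UNIV B" "\<And>x. 0 \<le> B x" "\<And>x. x \<notin> {0..1} \<Longrightarrow> B x = 0"
      "has_bochner_integral lborel B 1"
    and g: "continuous_on {0..} g" and p: "0 \<le> p"
  shows "(\<lambda>i. LINT x:{0<..}|lborel. g x * of_real (real (Suc i) * B (real (Suc i) * (x - p) - 1))) \<longlonglongrightarrow> g p"
proof -
  \<comment> \<open>The change of variables that undoes the scaling: the mass sits over
    [p + 1/r, p + 2/r] with r = i + 1. It lies strictly to the right of p, so one-sided continuity
    of g suffices at p = 0, and it stays within [p, p + 2], where one bound for g serves all
    i.\<close>
  define \<rho> where "\<rho> i y = p + (1 + y) / real (Suc i)" for i y
  define G where "G i y = indicator {0..1} y *\<^sub>R (g (\<rho> i y) * of_real (B y))" for i y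
  have \<rho>: "\<rho> i y \<in> {p..p+2}" "\<rho> i y > 0" if "y \<in> {0..1}" for i y
  proof -
    have "(1 + y) / real (Suc i) \<le> 2 / 1" using that by (intro frac_le) auto
    moreover have "(1 + y) / real (Suc i) > 0" using that by (intro divide_pos_pos) auto
    ultimately show "\<rho> i y \<in> {p..p+2}" "\<rho> i y > 0" using p by (auto simp: \<rho>_def)
  qed
  have I: "(LINT x:{0<..}|lborel. g x * of_real (real (Suc i) * B (real (Suc i) * (x - p) - 1))) =
      integral\<^sup>L lborel (G i)" for i
  proof -
    define r where "r = real (Suc i)"
    have r: "r > 0" by (simp add: r_def)
    have \<rho>r: "\<rho> i y = p + (1 + y) / r" for y by (simp add: \<rho>_def r_def)
    have "(LINT x:{0<..}|lborel. g x * of_real (r * B (r * (x - p) - 1))) =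
        \<bar>1 / r\<bar> *\<^sub>R (LINT y|lborel. indicator {0<..} ((p + 1 / r) + 1 / r * y) *\<^sub>R
          (g ((p + 1 / r) + 1 / r * y) * of_real (r * B (r * (((p + 1 / r) + 1 / r * y) - p) - 1))))"
      unfolding set_lebesgue_integral_def using r by (intro lborel_integral_real_affine) auto
    also have "\<dots> = (LINT y|lborel. \<bar>1 / r\<bar> *\<^sub>R (indicator {0<..} ((p + 1 / r) + 1 / r * y) *\<^sub>R
          (g ((p + 1 / r) + 1 / r * y) * of_real (r * B (r * (((p + 1 / r) + 1 / r * y) - p) - 1)))))"
      by (rule integral_scaleR_right[symmetric])
    also have "\<dots> = integral\<^sup>L lborel (G i)"
    proof (rule Bochner_Integration.integral_cong[OF refl])
      fix y :: real
      have *: "(p + 1 / r) + 1 / r * y = \<rho> i y" "r * (\<rho> i y - p) - 1 = y"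
        using r by (simp_all add: \<rho>r field_simps)
      show "\<bar>1 / r\<bar> *\<^sub>R (indicator {0<..} ((p + 1 / r) + 1 / r * y) *\<^sub>R
          (g ((p + 1 / r) + 1 / r * y) * of_real (r * B (r * (((p + 1 / r) + 1 / r * y) - p) - 1)))) = G i y"
        unfolding * using r \<rho>[of y i] B(3)[of y]
        by (cases "y \<in> {0..1}") (auto simp: G_def scaleR_conv_of_real field_simps)
    qed
    finally show ?thesis by (simp add: r_def)
  qed
  have "bounded (g ` {p..p+2})"
    using g p by (intro compact_imp_bounded compact_continuous_image) (auto intro: continuous_on_subset)
  then obtain M where M: "\<And>x. x \<in> {p..p+2} \<Longrightarrow> norm (g x) \<le> M"
    unfolding bounded_iff by blast
  have "(\<lambda>i. integral\<^sup>L lborel (G i)) \<longlonglongrightarrow> (LINT y|lborel. g p * of_real (B y))"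
  proof (rule integral_dominated_convergence[where w = "\<lambda>y. M * B y"])
    have "B \<in> borel_measurable borel"
      using B(1) by (rule borel_measurable_continuous_onI)
    then show "(\<lambda>y. g p * of_real (B y)) \<in> borel_measurable lborel" by simp
    show "G i \<in> borel_measurable lborel" for i
    proof -
      have "continuous_on {0..1} (\<lambda>y. g (\<rho> i y) * of_real (B y))"
      proof (intro continuous_intros continuous_on_compose2[OF g])
        show "continuous_on {0..1} (\<rho> i)" unfolding \<rho>_def by (intro continuous_intros) auto
        show "\<rho> i ` {0..1} \<subseteq> {0..}" using \<rho>(1)[of _ i] p by (intro image_subsetI) fastforce
        show "continuous_on {0..1} B" using B(1) by (rule continuous_on_subset) auto
      qed
      then show ?thesis
        unfolding G_def [abs_def] measurable_lborel2
        by (intro borel_measurable_continuous_on_indicator) auto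
    qed
    show "integrable lborel (\<lambda>y. M * B y)"
      using B(4) by (auto simp: has_bochner_integral_iff)
    show "AE y in lborel. (\<lambda>i. G i y) \<longlonglongrightarrow> g p * of_real (B y)"
    proof (intro AE_I2)
      fix y :: real
      show "(\<lambda>i. G i y) \<longlonglongrightarrow> g p * of_real (B y)"
      proof (cases "y \<in> {0..1}")
        case True
        have "(\<lambda>i. \<rho> i y) \<longlonglongrightarrow> p + 0"
          unfolding \<rho>_def by (intro tendsto_add tendsto_const LIMSEQ_Suc[OF lim_const_over_n])
        moreover have "\<rho> i y \<in> {0..}" for i using \<rho>(2)[OF True, of i] by simp
        ultimately have "(\<lambda>i. g (\<rho> i y)) \<longlonglongrightarrow> g p"
          using p by (intro continuous_on_tendsto_compose[OF g]) auto
        then show ?thesis using True by (auto simp: G_def intro: tendsto_mult_right)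
      next
        case False
        then show ?thesis using B(3)[OF False] by (simp add: G_def)
      qed
    qed
    show "AE y in lborel. norm (G i y) \<le> M * B y" for i
    proof (intro AE_I2)
      fix y :: real
      show "norm (G i y) \<le> M * B y"
      proof (cases "y \<in> {0..1}")
        case True
        then have "norm (g (\<rho> i y)) * B y \<le> M * B y"
          by (intro mult_right_mono M \<rho> B(2))
        then show ?thesis using True B(2)[of y] by (auto simp: G_def norm_mult)
      next
        case False
        then show ?thesis using B(3)[OF False] by (simp add: G_def)
      qed
    qed
  qed
  moreover have "(LINT y|lborel. g p * of_real (B y)) = g p"
    using B(4) by (simp add: has_bochner_integral_iff)
  ultimately show ?thesis by (simp only: I)
qed

text \<open>The test functions are differences of two steps, climbing just to the right of p and
  descending just to the right of q. They tend to the indicator of the interval, while their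
  derivatives are a difference of two approximate identities, which by
  \<open>approx_identity\<close> produce g(p) - g(q).\<close>

lemma weak_deriv_FTC:
  assumes w: "is_weak_deriv g h" and g: "continuous_on {0..} g" "loc_int g" and h: "loc_int h"
    and pq: "0 \<le> p" "p \<le> q"
  shows "(LINT x:{p<..q}|lborel. h x) = g q - g p"
proof -
  obtain S B :: "real \<Rightarrow> real" where SB:
    "\<And>m. n_times_diff m S" "\<And>x. (S has_real_derivative B x) (at x)" "continuous_on UNIV B" "\<And>x. 0 \<le> B x"
    "\<And>x. x \<notin> {0..1} \<Longrightarrow> B x = 0" "\<And>x. x \<le> 0 \<Longrightarrow> S x = 0" "\<And>x. x \<ge> 1 \<Longrightarrow> S x = 1"
    "\<And>x. 0 \<le> S x" "\<And>x. S x \<le> 1"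
    by (rule smooth_step_exists) (rule that)
  have "has_bochner_integral lborel (\<lambda>x. B x * indicator {0..1} x) (S 1 - S 0)"
    using SB(2,3) by (intro has_bochner_integral_FTC_Icc_real) (auto simp: continuous_on_eq_continuous_at)
  also have "(\<lambda>x. B x * indicator {0..1} x) = B"
    using SB(5) by (auto simp: fun_eq_iff indicator_def)
  finally have B1: "has_bochner_integral lborel B 1"
    using SB(6)[of 0] SB(7)[of 1] by simp
  define r where "r i = real (Suc i)" for i
  have r: "r i \<ge> 1" for i by (simp add: r_def)
  define \<phi> where "\<phi> i x = S (r i * x + (- r i * p - 1)) + (- 1) * S (r i * x + (- r i * q - 1))" for i x
  have d\<phi>: "(\<phi> i has_real_derivative (r i * B (r i * (x - p) - 1) - r i * B (r i * (x - q) - 1))) (at x)" for i x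
  proof -
    have "((\<lambda>x. r i * x + z) has_real_derivative r i) (at x)" for z
      by (auto intro!: derivative_eq_intros)
    then have "((\<lambda>x. S (r i * x + z)) has_real_derivative B (r i * x + z) * r i) (at x)" for z
      by (intro DERIV_chain2[of S] SB(2))
    from DERIV_add[OF this DERIV_cmult[OF this]] show ?thesis
      unfolding \<phi>_def by (rule DERIV_cong) (simp add: algebra_simps)
  qed
  have der: "deriv (\<phi> i) x = r i * B (r i * (x - p) - 1) - r i * B (r i * (x - q) - 1)" for i x
    using d\<phi> by (rule DERIV_imp_deriv)
  have S1: "S (r i * x + (- r i * y - 1)) = 0" if "x \<le> y + 1 / r i" for i x y
  proof -
    have "r i * x \<le> r i * (y + 1 / r i)" using that r[of i] by (intro mult_left_mono) auto
    then show ?thesis using r[of i] by (intro SB(6)) (simp add: algebra_simps)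
  qed
  have S2: "S (r i * x + (- r i * y - 1)) = 1" if "x \<ge> y + 2 / r i" for i x y
  proof -
    have "r i * x \<ge> r i * (y + 2 / r i)" using that r[of i] by (intro mult_left_mono) auto
    then show ?thesis using r[of i] by (intro SB(7)) (simp add: algebra_simps)
  qed
  \<comment> \<open>To the left of p + 1/r both steps vanish; to the right of q + 2 both equal 1 and
    cancel. The shift by -1 in the steps keeps the support away from 0 even for p = 0.\<close>
  have supp: "\<phi> i x = 0" if "x \<notin> {p + 1 / r i..q + 2}" for i x
  proof -
    have "0 < 1 / r i" "2 / r i \<le> 2" using r[of i] by (auto simp: field_simps)
    then show ?thesis
      using that pq S1[of x p i] S1[of x q i] S2[of p i x] S2[of q i x] unfolding \<phi>_def by force
  qed
  have t: "test_fun (\<phi> i)" for i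
  proof -
    have "n_times_diff m (\<phi> i)" for m
      unfolding \<phi>_def by (intro n_times_diff_add n_times_diff_mult n_times_diff_const n_times_diff_affine SB(1))
    then have "\<forall>m x. (deriv ^^ m) (\<phi> i) differentiable (at x)"
      using smooth_iff_n_times_diff by blast
    moreover have "0 < 1 / r i" "1 / r i \<le> 1" using r[of i] by auto
    then have "0 < p + 1 / r i" "p + 1 / r i < q + 2" using pq by linarith+
    ultimately show ?thesis using supp unfolding test_fun_def by blast
  qed
  have cont\<phi>: "continuous_on UNIV (\<phi> i)" for i
    by (intro continuous_at_imp_continuous_on ballI DERIV_isCont[OF d\<phi>])
  have cB: "continuous_on UNIV (\<lambda>x. r i * B (r i * (x - y) - 1))" for i y
    by (intro continuous_intros continuous_on_compose2[OF SB(3)]) auto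
  have Bsupp: "r i * B (r i * (x - y) - 1) = 0" if "0 \<le> y" "x \<notin> {0..y+2}" for i x y
  proof -
    have "r i * (x - y) - 1 \<notin> {0..1}"
    proof
      assume *: "r i * (x - y) - 1 \<in> {0..1}"
      have "x - y \<ge> 0"
      proof (rule ccontr)
        assume "\<not> x - y \<ge> 0"
        then have "r i * (x - y) \<le> 0" using r[of i] by (intro mult_nonneg_nonpos) auto
        then show False using * by auto
      qed
      moreover from this have "1 * (x - y) \<le> r i * (x - y)" using r[of i] by (intro mult_right_mono) auto
      ultimately show False using * that by auto
    qed
    then show ?thesis using SB(5) by simp
  qed
  have gB: "set_integrable lborel {0<..} (\<lambda>x. g x * of_real (r i * B (r i * (x - y) - 1)))" if "0 \<le> y" for i y
    by (rule loc_int_times_test[OF g(2) cB Bsupp]) (use that in auto)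
  have "(\<lambda>i. LINT x:{0<..}|lborel. g x * of_real (deriv (\<phi> i) x)) \<longlonglongrightarrow> g p - g q"
  proof -
    have "(LINT x:{0<..}|lborel. g x * of_real (deriv (\<phi> i) x)) =
      (LINT x:{0<..}|lborel. g x * of_real (r i * B (r i * (x - p) - 1))) -
      (LINT x:{0<..}|lborel. g x * of_real (r i * B (r i * (x - q) - 1)))" for i
      using gB[of p i] gB[of q i] pq
      by (subst set_integral_diff(2)[symmetric]) (auto simp: der right_diff_distrib)
    then show ?thesis
      using approx_identity[OF SB(3,4,5) B1 g(1), of p] approx_identity[OF SB(3,4,5) B1 g(1), of q] pq
      by (simp add: r_def tendsto_diff)
  qed
  moreover have "(\<lambda>i. LINT x:{0<..}|lborel. h x * of_real (\<phi> i x)) \<longlonglongrightarrow> (LINT x:{p<..q}|lborel. h x)"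
    unfolding set_lebesgue_integral_def
  proof (rule integral_dominated_convergence[where w = "\<lambda>x. norm (indicator {0<..q+2} x *\<^sub>R h x)"])
    have hq: "set_integrable lborel {0<..q+2} h" using h by (simp add: loc_int_def)
    then show "integrable lborel (\<lambda>x. norm (indicator {0<..q+2} x *\<^sub>R h x))"
      unfolding set_integrable_def by (rule integrable_norm)
    have "set_integrable lborel {p<..q} h"
      by (rule set_integrable_subset[OF hq]) (use pq in auto)
    then show "(\<lambda>x. indicator {p<..q} x *\<^sub>R h x) \<in> borel_measurable lborel"
      unfolding set_integrable_def by (rule borel_measurable_integrable)
    have "set_integrable lborel {0<..} (\<lambda>x. h x * of_real (\<phi> i x))" for i
      by (rule loc_int_times_test[OF h cont\<phi> supp])
    then show "(\<lambda>x. indicator {0<..} x *\<^sub>R (h x * of_real (\<phi> i x))) \<in> borel_measurable lborel" for i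
      unfolding set_integrable_def by (rule borel_measurable_integrable)
    have r0: "(\<lambda>i. z / r i) \<longlonglongrightarrow> 0" for z :: real
      unfolding r_def by (rule LIMSEQ_Suc[OF lim_const_over_n])
    \<comment> \<open>The step becomes stationary at each point; at x = y its value is 0, which is
      why the limiting interval is open on the left and closed on the right.\<close>
    have ev: "\<forall>\<^sub>F i in sequentially. S (r i * x + (- r i * y - 1)) = (if x \<le> y then 0 else 1)" for x y
    proof (cases "x \<le> y")
      case True
      have "0 < 1 / r i" for i using r[of i] by auto
      then have "S (r i * x + (- r i * y - 1)) = 0" for i
        using True by (intro S1) (simp add: add_increasing2 less_imp_le)
      with True show ?thesis by simp
    next
      case False
      then have "\<forall>\<^sub>F i in sequentially. 2 / r i < x - y"
        by (intro order_tendstoD(2)[OF r0]) auto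
      then show ?thesis
      proof eventually_elim
        case (elim i)
        then show ?case using False S2[of y i x] by auto
      qed
    qed
    show "AE x in lborel. (\<lambda>i. indicator {0<..} x *\<^sub>R (h x * of_real (\<phi> i x))) \<longlonglongrightarrow> indicator {p<..q} x *\<^sub>R h x"
    proof (intro AE_I2 tendsto_eventually)
      fix x :: real
      show "\<forall>\<^sub>F i in sequentially. indicator {0<..} x *\<^sub>R (h x * of_real (\<phi> i x)) = indicator {p<..q} x *\<^sub>R h x"
        using ev[of x p] ev[of x q]
      proof eventually_elim
        case (elim i)
        then show ?case using pq by (auto simp: \<phi>_def indicator_def)
      qed
    qed
    show "AE x in lborel. norm (indicator {0<..} x *\<^sub>R (h x * of_real (\<phi> i x))) \<le> norm (indicator {0<..q+2} x *\<^sub>R h x)" for i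
    proof (intro AE_I2)
      fix x :: real
      have "\<bar>\<phi> i x\<bar> \<le> 1"
        unfolding \<phi>_def using SB(8,9)[of "r i * x + (- r i * p - 1)"] SB(8,9)[of "r i * x + (- r i * q - 1)"] by linarith
      then have "norm (h x) * \<bar>\<phi> i x\<bar> \<le> norm (h x) * 1" by (intro mult_left_mono) auto
      moreover have "0 < 1 / r i" using r[of i] by auto
      ultimately show "norm (indicator {0<..} x *\<^sub>R (h x * of_real (\<phi> i x))) \<le> norm (indicator {0<..q+2} x *\<^sub>R h x)"
        using supp[of x i] pq by (auto simp: indicator_def norm_mult)
    qed
  qed
  then have "(\<lambda>i. - (LINT x:{0<..}|lborel. h x * of_real (\<phi> i x))) \<longlonglongrightarrow> - (LINT x:{p<..q}|lborel. h x)"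
    by (rule tendsto_minus)
  ultimately have "g p - g q = - (LINT x:{p<..q}|lborel. h x)"
    unfolding is_weak_derivD[OF w t] by (rule LIMSEQ_unique)
  then show ?thesis by (simp add: algebra_simps)
qed

section \<open>Powers times decaying exponentials, and integrals over half-lines\<close>

lemma set_integral_power_exp:
  fixes b :: real
  assumes "b > 0"
  shows "set_integrable lborel {0<..} (\<lambda>x. x ^ k * exp (- b * x))"
    and "(LINT x:{0<..}|lborel. x ^ k * exp (- b * x)) = fact k / b ^ Suc k"
proof -
  have "has_bochner_integral lborel (\<lambda>x. (0 + b * x) ^ k * exp (- (0 + b * x)) * indicator {0<..} (0 + b * x)) (fact k /\<^sub>R \<bar>b\<bar>)"
    using has_bochner_integral_I0i_power_exp_m[of k] assms
    by (subst lborel_has_bochner_integral_real_affine_iff[symmetric]) auto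
  then have "has_bochner_integral lborel (\<lambda>x. inverse (b ^ k) * ((0 + b * x) ^ k * exp (- (0 + b * x)) * indicator {0<..} (0 + b * x)))
      (inverse (b ^ k) * (fact k /\<^sub>R \<bar>b\<bar>))"
    by (rule has_bochner_integral_mult_right[rotated])
  also have "(\<lambda>x. inverse (b ^ k) * ((0 + b * x) ^ k * exp (- (0 + b * x)) * indicator {0<..} (0 + b * x)))
      = (\<lambda>x. indicator {0<..} x *\<^sub>R (x ^ k * exp (- b * x)))"
    using assms by (auto simp: fun_eq_iff indicator_def power_mult_distrib zero_less_mult_iff)
  also have "inverse (b ^ k) * (fact k /\<^sub>R \<bar>b\<bar>) = fact k / b ^ Suc k"
    using assms by (simp add: field_simps)
  finally show "set_integrable lborel {0<..} (\<lambda>x. x ^ k * exp (- b * x))"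
    "(LINT x:{0<..}|lborel. x ^ k * exp (- b * x)) = fact k / b ^ Suc k"
    by (auto simp: has_bochner_integral_iff set_integrable_def set_lebesgue_integral_def)
qed

lemma L2_power_exp:
  assumes "Re \<beta> < 0"
  shows "L2 (\<lambda>x. of_real x ^ k * exp (\<beta> * of_real x))"
  unfolding L2_def
proof
  show "set_borel_measurable lborel {0<..} (\<lambda>x. of_real x ^ k * exp (\<beta> * of_real x))"
    unfolding set_borel_measurable_def measurable_lborel2
    by (intro borel_measurable_continuous_on_indicator continuous_intros) auto
  have "(norm (of_real x ^ k * exp (\<beta> * of_real x)))^2 = x ^ (2 * k) * exp (- (- 2 * Re \<beta>) * x)" for x
  proof -
    have "(norm (of_real x ^ k * exp (\<beta> * of_real x)))^2 = (x^2)^k * (exp (Re \<beta> * x))^2"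
      by (simp add: norm_mult norm_power power_mult_distrib power_mult[symmetric] mult.commute[of k 2] power_even_abs)
    then show ?thesis
      unfolding power_mult[of x 2 k] by (simp add: exp_double[symmetric] mult_ac)
  qed
  then show "set_integrable lborel {0<..} (\<lambda>x. (norm (of_real x ^ k * exp (\<beta> * of_real x)))^2)"
    using set_integral_power_exp(1)[of "- 2 * Re \<beta>" "2 * k"] assms by simp
qed

lemma L2_exp: "Re \<beta> < 0 \<Longrightarrow> L2 (\<lambda>x. exp (\<beta> * of_real x))"
  using L2_power_exp[of \<beta> 0] by simp

lemma L2_cmult: "L2 g \<Longrightarrow> L2 (\<lambda>x. k * g x)"
proof -
  assume g: "L2 g"
  have "(\<lambda>x. k * (indicator {0<..} x *\<^sub>R g x)) \<in> borel_measurable lborel"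
    using g unfolding L2_def set_borel_measurable_def by (intro borel_measurable_times) auto
  then show "L2 (\<lambda>x. k * g x)"
    using g by (simp add: L2_def set_borel_measurable_def norm_mult power_mult_distrib)
qed

lemma L2_add:
  assumes "L2 g" "L2 h" shows "L2 (\<lambda>x. g x + h x)"
  unfolding L2_def
proof
  have "(\<lambda>x. indicator {0<..} x *\<^sub>R g x + indicator {0<..} x *\<^sub>R h x) \<in> borel_measurable lborel"
    using assms unfolding L2_def set_borel_measurable_def by (intro borel_measurable_add) auto
  then have m: "(\<lambda>x. indicator {0<..} x *\<^sub>R (g x + h x)) \<in> borel_measurable lborel"
    by (simp add: scaleR_add_right)
  then show "set_borel_measurable lborel {0<..} (\<lambda>x. g x + h x)"
    by (simp add: set_borel_measurable_def)
  have "set_integrable lborel {0<..} (\<lambda>x. 2 * (norm (g x))^2 + 2 * (norm (h x))^2)"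
    using assms by (intro set_integral_add set_integrable_mult_right) (auto simp: L2_def)
  then show "set_integrable lborel {0<..} (\<lambda>x. (norm (g x + h x))^2)"
  proof (rule set_integrable_bound)
    have "(\<lambda>x. (norm (indicator {0<..} x *\<^sub>R (g x + h x)))^2) \<in> borel_measurable lborel"
      by (intro borel_measurable_power measurable_compose[OF m borel_measurable_norm])
    also have "(\<lambda>x. (norm (indicator {0<..} x *\<^sub>R (g x + h x)))^2) =
        (\<lambda>x. indicator {0<..} x *\<^sub>R (norm (g x + h x))^2)"
      by (auto simp: fun_eq_iff indicator_def)
    finally show "set_borel_measurable lborel {0<..} (\<lambda>x. (norm (g x + h x))^2)"
      by (simp add: set_borel_measurable_def)
    have "(norm (g x + h x))^2 \<le> 2 * (norm (g x))^2 + 2 * (norm (h x))^2" for x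
    proof -
      have "(norm (g x + h x))^2 \<le> (norm (g x) + norm (h x))^2"
        by (intro power_mono norm_triangle_ineq) auto
      moreover have "0 \<le> (norm (g x) - norm (h x))^2" by simp
      ultimately show ?thesis unfolding power2_sum power2_diff by linarith
    qed
    then show "AE x in lborel. x \<in> {0<..} \<longrightarrow> norm ((norm (g x + h x))^2) \<le> norm (2 * (norm (g x))^2 + 2 * (norm (h x))^2)"
      by (intro AE_I2) simp
  qed
qed

text \<open>This disposes of the boundary term at infinity. A nonzero limit L would bound |G| below
  by |L|/2 on a half-line, which has infinite measure.\<close>

lemma integrable_tendsto_at_top_imp_zero:
  fixes G :: "real \<Rightarrow> complex"
  assumes G: "set_integrable lborel {0<..} G" and L: "(G \<longlongrightarrow> L) at_top"
  shows "L = 0"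
proof (rule ccontr)
  assume "L \<noteq> 0"
  then have "norm L / 2 < norm L" by simp
  then have "\<forall>\<^sub>F x in at_top. norm L / 2 < norm (G x)"
    using tendsto_norm[OF L] by (rule order_tendstoD(1)[rotated])
  then obtain N where N: "\<And>x. x \<ge> N \<Longrightarrow> norm L / 2 < norm (G x)"
    by (auto simp: eventually_at_top_linorder)
  define m where "m = max N 0"
  have "set_integrable lborel {m<..} G"
    by (rule set_integrable_subset[OF G]) (auto simp: m_def)
  then have "set_integrable lborel {m<..} (\<lambda>x. norm L / 2)"
  proof (rule set_integrable_bound)
    show "set_borel_measurable lborel {m<..} (\<lambda>x. norm L / 2)"
      unfolding set_borel_measurable_def measurable_lborel2
      by (intro borel_measurable_continuous_on_indicator continuous_intros) auto
    show "AE x in lborel. x \<in> {m<..} \<longrightarrow> norm (norm L / 2) \<le> norm (G x)"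
      using N by (intro AE_I2) (auto simp: m_def intro!: less_imp_le)
  qed
  then have "integrable lborel (\<lambda>x. (2 / norm L) * (indicator {m<..} x *\<^sub>R (norm L / 2)))"
    by (intro integrable_mult_right) (simp add: set_integrable_def)
  then have "integrable lborel (indicator {m<..} :: real \<Rightarrow> real)"
    using \<open>L \<noteq> 0\<close> by simp
  then have "emeasure lborel {m<..} < \<infinity>"
    by (simp add: integrable_indicator_iff)
  then obtain r where r: "emeasure lborel {m<..} = ennreal r" "r \<ge> 0"
    by (cases "emeasure lborel {m<..}") auto
  have "emeasure lborel {m<..m + (r + 1)} \<le> emeasure lborel {m<..}"
    by (intro emeasure_mono) auto
  then show False using r by simp
qed

text \<open>This is the shape of the kernel on the branch of x, with the diagonal point x' = x
  assigned to the left piece as in \<open>K_fun\<close>.\<close>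

lemma set_integral_if_gt:
  fixes g1 g2 :: "real \<Rightarrow> complex"
  assumes t: "0 \<le> t" and g1: "set_integrable lborel {0<..t} g1" and g2: "set_integrable lborel {t<..} g2"
  shows "set_integrable lborel {0<..} (\<lambda>x. if x > t then g2 x else g1 x)"
    and "(LINT x:{0<..}|lborel. if x > t then g2 x else g1 x) =
      (LINT x:{0<..t}|lborel. g1 x) + (LINT x:{t<..}|lborel. g2 x)"
proof -
  let ?g = "\<lambda>x. if x > t then g2 x else g1 x"
  have 1: "set_integrable lborel {0<..t} ?g"
    using g1 by (rule set_integrable_cong[THEN iffD1, rotated 3]) auto
  have 2: "set_integrable lborel {t<..} ?g"
    using g2 by (rule set_integrable_cong[THEN iffD1, rotated 3]) auto
  have U: "{0<..} = {0<..t} \<union> {t<..}" using t by auto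
  show "set_integrable lborel {0<..} ?g"
    unfolding U by (intro set_integrable_Un 1 2) auto
  have "(LINT x:{0<..}|lborel. ?g x) = (LINT x:{0<..t}|lborel. ?g x) + (LINT x:{t<..}|lborel. ?g x)"
    unfolding U by (intro set_integral_Un 1 2) auto
  also have "(LINT x:{0<..t}|lborel. ?g x) = (LINT x:{0<..t}|lborel. g1 x)"
    by (rule set_lebesgue_integral_cong) auto
  also have "(LINT x:{t<..}|lborel. ?g x) = (LINT x:{t<..}|lborel. g2 x)"
    by (rule set_lebesgue_integral_cong) auto
  finally show "(LINT x:{0<..}|lborel. ?g x) =
      (LINT x:{0<..t}|lborel. g1 x) + (LINT x:{t<..}|lborel. g2 x)" .
qed

section \<open>Lagrange's identity on a branch\<close>

text \<open>The vertex conditions are left out, so that every branch can be instantiated separately;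
  they enter only when the contributions of the branches are added.\<close>

locale branch_solution =
  fixes c a :: real and lam :: complex and u d e f :: "real \<Rightarrow> complex"
  assumes L2: "L2 u" "L2 d" "L2 e" "L2 f"
    and cont: "continuous_on {0..} u" "continuous_on {0..} d"
    and weak: "is_weak_deriv u d" "is_weak_deriv d e"
    and eq: "AE x in lborel. x > 0 \<longrightarrow> lam * u x - (- of_real c * e x + of_real a * u x) = f x"
begin

text \<open>For g = exp(\<kappa>t)(u' - \<kappa>u) the terms with u' cancel in g', leaving
  exp(\<kappa>t)(u'' - \<kappa>^2 u). Multiplied by c, and with c \<kappa>^2 = a - \<lambda>, this
  is exp(\<kappa>t) f. The sign of the root is left open because both roots occur on the branch of
  x.\<close>

lemma lagrange:
  assumes \<kappa>: "of_real c * \<kappa>^2 = of_real a - lam" and xy: "0 \<le> x" "x \<le> y"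
  shows "(LINT t:{x<..y}|lborel. exp (\<kappa> * of_real t) * f t) =
    of_real c * (exp (\<kappa> * of_real y) * (d y - \<kappa> * u y) - exp (\<kappa> * of_real x) * (d x - \<kappa> * u x))"
proof -
  let ?E = "\<lambda>t. exp (\<kappa> * complex_of_real t)"
  note li = L2[THEN L2_loc_int]
  have cE: "continuous_on UNIV ?E" by (intro continuous_intros)
  \<comment> \<open>Both are written exactly as the sum, scalar and exponential rules for weak
    derivatives generate them; the simplification of \<open>h\<close> is postponed to the comparison
    with f.\<close>
  define g h where "g t = ?E t * d t + (- \<kappa>) * (?E t * u t)"
    and "h t = (?E t * e t + \<kappa> * (?E t * d t)) + (- \<kappa>) * (?E t * d t + \<kappa> * (?E t * u t))" for t
  have lg: "loc_int g" and lh: "loc_int h"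
    unfolding g_def h_def by (intro loc_int_add loc_int_cmult loc_int_mult_continuous li cE)+
  have "is_weak_deriv g h"
    unfolding g_def h_def
    by (intro is_weak_deriv_add is_weak_deriv_cmult is_weak_deriv_exp_mult weak loc_int_add
        loc_int_cmult loc_int_mult_continuous li cE)
  moreover have "continuous_on {0..} g"
    unfolding g_def by (intro continuous_intros cont)
  ultimately have "(LINT t:{x<..y}|lborel. h t) = g y - g x"
    using lg lh xy by (intro weak_deriv_FTC)
  then have "of_real c * (g y - g x) = (LINT t:{x<..y}|lborel. of_real c * h t)" by simp
  also have "\<dots> = (LINT t:{x<..y}|lborel. ?E t * f t)"
    unfolding set_lebesgue_integral_def
  proof (rule integral_cong_AE)
    have "set_integrable lborel {x<..y} v" if "loc_int v" for v
      by (rule set_integrable_subset[of _ "{0<..y}"]) (use that xy in \<open>auto simp: loc_int_def\<close>)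
    then have m: "(\<lambda>t. indicator {x<..y} t *\<^sub>R v t) \<in> borel_measurable lborel" if "loc_int v" for v
      using that unfolding set_integrable_def by (intro borel_measurable_integrable)
    show "(\<lambda>t. indicator {x<..y} t *\<^sub>R (of_real c * h t)) \<in> borel_measurable lborel"
      by (intro m loc_int_cmult lh)
    show "(\<lambda>t. indicator {x<..y} t *\<^sub>R (?E t * f t)) \<in> borel_measurable lborel"
      by (intro m loc_int_mult_continuous li cE)
    show "AE t in lborel. indicator {x<..y} t *\<^sub>R (of_real c * h t) = indicator {x<..y} t *\<^sub>R (?E t * f t)"
      using eq
    proof eventually_elim
      case (elim t)
      have "of_real c * h t = ?E t * (of_real c * e t - (of_real c * \<kappa>^2) * u t)"
        by (simp add: h_def algebra_simps power2_eq_square)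
      also have "\<dots> = ?E t * f t" if "t > 0"
        using elim that unfolding \<kappa> by (auto simp: algebra_simps)
      finally show ?case using xy by (auto simp: indicator_def)
    qed
  qed
  finally show ?thesis by (simp add: g_def algebra_simps)
qed

text \<open>Convergence of the integrals over {x<..y} forces the boundary term at y to converge.
  That term is a product of two \<open>L2\<close> functions up to a constant, hence integrable, so
  its limit can only be 0; no separate decay estimate for u or u' enters.\<close>

lemma lagrange_at_top:
  assumes \<kappa>: "of_real c * \<kappa>^2 = of_real a - lam" "Re \<kappa> < 0" and x: "0 \<le> x"
  shows "set_integrable lborel {x<..} (\<lambda>t. exp (\<kappa> * of_real t) * f t)"
    and "(LINT t:{x<..}|lborel. exp (\<kappa> * of_real t) * f t) =
      - of_real c * (exp (\<kappa> * of_real x) * (d x - \<kappa> * u x))"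
proof -
  let ?E = "\<lambda>t. exp (\<kappa> * complex_of_real t)"
  define W where "W t = of_real c * (?E t * (d t - \<kappa> * u t))" for t
  have E: "L2 ?E" using \<kappa>(2) by (rule L2_exp)
  show int: "set_integrable lborel {x<..} (\<lambda>t. ?E t * f t)"
    by (rule set_integrable_subset[OF L2_mult_integrable[OF E L2(4)]]) (use x in auto)
  have lim: "((\<lambda>y. LINT t:{x<..y}|lborel. ?E t * f t) \<longlongrightarrow> (LINT t:{x<..}|lborel. ?E t * f t)) at_top"
    unfolding set_lebesgue_integral_def
  proof (rule integral_dominated_convergence_at_top[where w = "\<lambda>t. norm (indicator {x<..} t *\<^sub>R (?E t * f t))"])
    show "integrable lborel (\<lambda>t. norm (indicator {x<..} t *\<^sub>R (?E t * f t)))"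
      using int unfolding set_integrable_def by (rule integrable_norm)
    show "(\<lambda>t. indicator {x<..} t *\<^sub>R (?E t * f t)) \<in> borel_measurable lborel"
      using int unfolding set_integrable_def by (rule borel_measurable_integrable)
    have "set_integrable lborel {x<..y} (\<lambda>t. ?E t * f t)" for y
      by (rule set_integrable_subset[OF int]) auto
    then show "(\<lambda>t. indicator {x<..y} t *\<^sub>R (?E t * f t)) \<in> borel_measurable lborel" for y
      unfolding set_integrable_def by (rule borel_measurable_integrable)
    show "\<forall>\<^sub>F y in at_top. AE t in lborel. norm (indicator {x<..y} t *\<^sub>R (?E t * f t)) \<le> norm (indicator {x<..} t *\<^sub>R (?E t * f t))"
      by (intro always_eventually allI AE_I2) (auto simp: indicator_def)
    show "AE t in lborel. ((\<lambda>y. indicator {x<..y} t *\<^sub>R (?E t * f t)) \<longlongrightarrow> indicator {x<..} t *\<^sub>R (?E t * f t)) at_top"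
    proof (intro AE_I2 tendsto_eventually)
      fix t
      show "\<forall>\<^sub>F y in at_top. indicator {x<..y} t *\<^sub>R (?E t * f t) = indicator {x<..} t *\<^sub>R (?E t * f t)"
        using eventually_ge_at_top[of t] by eventually_elim (auto simp: indicator_def)
    qed
  qed
  have "((\<lambda>y. W y - W x) \<longlongrightarrow> (LINT t:{x<..}|lborel. ?E t * f t)) at_top"
    using lim
  proof (rule Lim_transform_eventually)
    show "\<forall>\<^sub>F y in at_top. (LINT t:{x<..y}|lborel. ?E t * f t) = W y - W x"
      using eventually_ge_at_top[of x]
      by eventually_elim (simp add: lagrange[OF \<kappa>(1) x] W_def right_diff_distrib)
  qed
  then have "((\<lambda>y. (W y - W x) + W x) \<longlongrightarrow> (LINT t:{x<..}|lborel. ?E t * f t) + W x) at_top"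
    by (intro tendsto_add tendsto_const)
  then have "(W \<longlongrightarrow> (LINT t:{x<..}|lborel. ?E t * f t) + W x) at_top" by simp
  moreover have "set_integrable lborel {0<..} (\<lambda>t. ?E t * (d t + (- \<kappa>) * u t))"
    by (intro L2_mult_integrable E L2_add L2_cmult L2)
  then have "set_integrable lborel {0<..} W"
    unfolding W_def by (intro set_integrable_mult_right) auto
  ultimately have "(LINT t:{x<..}|lborel. ?E t * f t) + W x = 0"
    by (intro integrable_tendsto_at_top_imp_zero)
  then show "(LINT t:{x<..}|lborel. ?E t * f t) =
      - of_real c * (exp (\<kappa> * of_real x) * (d x - \<kappa> * u x))"
    by (simp add: W_def add_eq_0_iff2)
qed

end

section \<open>The real spectrum\<close>

lemma continuous_imp_loc_int:
  assumes "continuous_on UNIV g" shows "loc_int g"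
  unfolding loc_int_def
proof
  fix q :: real
  have "set_integrable lborel {0..q} g"
    unfolding set_integrable_def
    by (intro borel_integrable_compact continuous_on_subset[OF assms]) auto
  then show "set_integrable lborel {0<..q} g"
    by (rule set_integrable_subset) auto
qed

text \<open>The opposite passage, from classical to weak derivatives: it certifies the explicit Weyl
  functions as elements of the domain.\<close>

lemma is_weak_deriv_classical:
  assumes d: "\<And>x. (g has_vector_derivative h x) (at x)" and h: "continuous_on UNIV h"
  shows "is_weak_deriv g h"
  unfolding is_weak_deriv_def
proof (intro allI impI)
  fix \<phi> assume t: "test_fun \<phi>"
  obtain p q where pq: "0 < p" "p < q" "\<And>x. x \<notin> {p..q} \<Longrightarrow> \<phi> x = 0"
    "\<And>x. x \<notin> {p..q} \<Longrightarrow> deriv \<phi> x = 0"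
    "\<And>x. (\<phi> has_real_derivative deriv \<phi> x) (at x)" "continuous_on UNIV \<phi>" "continuous_on UNIV (deriv \<phi>)"
    by (rule test_funD[OF t]) (rule that)
  have g: "continuous_on UNIV g"
    using has_vector_derivative_continuous[OF d] by (simp add: continuous_at_imp_continuous_on)
  define k where "k x = g x * of_real (deriv \<phi> x) + h x * of_real (\<phi> x)" for x
  have dk: "((\<lambda>x. g x * of_real (\<phi> x)) has_vector_derivative k x) (at x)" for x
    unfolding k_def
    by (intro has_vector_derivative_mult d has_vector_derivative_of_real)
       (use pq(5) in \<open>simp add: has_real_derivative_iff_has_vector_derivative\<close>)
  have ck: "continuous_on UNIV k"
    unfolding k_def by (intro continuous_intros g h pq)
  have "(LINT x:{0<..}|lborel. g x * of_real (deriv \<phi> x)) + (LINT x:{0<..}|lborel. h x * of_real (\<phi> x)) =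
      (LINT x:{0<..}|lborel. k x)"
    unfolding k_def
    by (intro set_integral_add(2)[symmetric] loc_int_times_test[OF continuous_imp_loc_int[OF g] pq(7,4)]
        loc_int_times_test[OF continuous_imp_loc_int[OF h] pq(6,3)])
  \<comment> \<open>The interval is slightly larger than the support [p, q], so that \<phi> vanishes
    at both endpoints, and its left end is still positive.\<close>
  also have "\<dots> = (LINT x|lborel. indicator {p / 2..q + 1} x *\<^sub>R k x)"
    unfolding set_lebesgue_integral_def
  proof (rule Bochner_Integration.integral_cong[OF refl])
    fix x :: real
    show "indicator {0<..} x *\<^sub>R k x = indicator {p / 2..q + 1} x *\<^sub>R k x"
      using pq(1,2) pq(3,4)[of x] by (cases "x \<in> {p..q}") (auto simp: k_def indicator_def)
  qed
  also have "\<dots> = g (q + 1) * of_real (\<phi> (q + 1)) - g (p / 2) * of_real (\<phi> (p / 2))"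
  proof (rule integral_FTC_Icc)
    show "p / 2 \<le> q + 1" using pq by simp
    show "((\<lambda>x. g x * of_real (\<phi> x)) has_vector_derivative k x) (at x within {p / 2..q + 1})" for x
      using dk by (rule has_vector_derivative_at_within)
    show "continuous_on {p / 2..q + 1} k" using ck by (rule continuous_on_subset) simp
  qed
  also have "\<dots> = 0" using pq(1,2) pq(3)[of "q + 1"] pq(3)[of "p / 2"] by simp
  finally show "(LINT x:{0<..}|lborel. g x * of_real (deriv \<phi> x)) = - (LINT x:{0<..}|lborel. h x * of_real (\<phi> x))"
    by (simp add: eq_neg_iff_add_eq_0)
qed

text \<open>Quadratic polynomials times a fixed exponential form a space closed under
  differentiation; on the coefficients (p, q, r) the derivative is a linear map. Applied twice to
  (0, 0, 1) it yields the derivatives of the Weyl functions.\<close>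

lemma quad_exp_has_derivative:
  fixes p q r \<beta> :: complex
  shows
  "((\<lambda>x::real. (p + q * of_real x + r * (of_real x)^2) * exp (\<beta> * of_real x)) has_vector_derivative
    ((q + p * \<beta>) + (2 * r + q * \<beta>) * of_real x + (r * \<beta>) * (of_real x)^2) * exp (\<beta> * of_real x)) (at x)"
proof -
  have "((\<lambda>z. (p + q * z + r * z^2) * exp (\<beta> * z)) has_field_derivative
    ((q + p * \<beta>) + (2 * r + q * \<beta>) * z + (r * \<beta>) * z^2) * exp (\<beta> * z)) (at z)" for z :: complex
    by (auto intro!: derivative_eq_intros simp: algebra_simps power2_eq_square)
  then show ?thesis
    by (rule has_vector_derivative_real_field[unfolded comp_def])
qed

lemma L2_quad_exp:
  assumes "Re \<beta> < 0"
  shows "L2 (\<lambda>x. (p + q * of_real x + r * (of_real x)^2) * exp (\<beta> * of_real x))"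
proof -
  have "L2 (\<lambda>x. p * (of_real x ^ 0 * exp (\<beta> * of_real x)) + q * (of_real x ^ 1 * exp (\<beta> * of_real x))
      + r * (of_real x ^ 2 * exp (\<beta> * of_real x)))"
    by (intro L2_add L2_cmult L2_power_exp assms)
  then show ?thesis by (simp add: algebra_simps)
qed

text \<open>The integral of x^4 exp(-2\<epsilon>x) is of order \<epsilon>^-5; the extra factor
  \<epsilon> in the bound of the quadratic coefficient, once squared, brings it down to the order
  \<epsilon>^-3 of the linear term. The 6 is 3, from the square of a sum of three terms, times 2, a
  bound for \<epsilon>^2/2 + 1.\<close>

lemma quad_exp_norm_bound:
  fixes p q r \<epsilon> :: real
  assumes \<epsilon>: "0 < \<epsilon>" "\<epsilon> \<le> 1" and \<beta>: "Re \<beta> = - \<epsilon>" and M: "0 \<le> M"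
    and bd: "norm z0 \<le> M" "norm z1 \<le> M" "norm z2 \<le> M * \<epsilon>"
  shows "(LINT x:{0<..}|lborel. (norm ((z0 + z1 * of_real x + z2 * (of_real x)^2) * exp (\<beta> * of_real x)))^2)
      \<le> 6 * M^2 / \<epsilon>^3"
proof -
  let ?v = "\<lambda>k x. x ^ k * exp (- (2 * \<epsilon>) * x)"
  have vi: "set_integrable lborel {0<..} (?v k)" and vv: "(LINT x:{0<..}|lborel. ?v k x) = fact k / (2 * \<epsilon>) ^ Suc k" for k
    using set_integral_power_exp[of "2 * \<epsilon>" k] \<epsilon> by auto
  have "(LINT x:{0<..}|lborel. (norm ((z0 + z1 * of_real x + z2 * (of_real x)^2) * exp (\<beta> * of_real x)))^2)
      \<le> (LINT x:{0<..}|lborel. 3 * M^2 * (?v 0 x + ?v 2 x + \<epsilon>^2 * ?v 4 x))"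
  proof (rule set_integral_mono)
    have "L2 (\<lambda>x. (z0 + z1 * of_real x + z2 * (of_real x)^2) * exp (\<beta> * of_real x))"
      using \<epsilon> \<beta> by (intro L2_quad_exp) simp
    then show "set_integrable lborel {0<..} (\<lambda>x. (norm ((z0 + z1 * of_real x + z2 * (of_real x)^2) * exp (\<beta> * of_real x)))^2)"
      by (simp add: L2_def)
    show "set_integrable lborel {0<..} (\<lambda>x. 3 * M^2 * (?v 0 x + ?v 2 x + \<epsilon>^2 * ?v 4 x))"
      by (intro set_integrable_mult_right set_integral_add vi)
    fix x :: real assume x: "x \<in> {0<..}"
    have "norm (z0 + z1 * of_real x + z2 * (of_real x)^2) \<le> norm z0 + norm z1 * x + norm z2 * x^2"
      using x by (intro order_trans[OF norm_triangle_ineq] add_mono) (auto simp: norm_mult norm_power)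
    also have "\<dots> \<le> M + M * x + (M * \<epsilon>) * x^2"
      using x bd by (intro add_mono mult_right_mono) auto
    finally have "(norm (z0 + z1 * of_real x + z2 * (of_real x)^2))^2 \<le> (M + M * x + (M * \<epsilon>) * x^2)^2"
      by (intro power_mono) auto
    also have "\<dots> \<le> 3 * (M^2 + (M * x)^2 + ((M * \<epsilon>) * x^2)^2)"
    proof -
      have "3 * (A^2 + B^2 + C^2) - (A + B + C)^2 = (A - B)^2 + (B - C)^2 + (A - C)^2" for A B C :: real
        by (simp add: power2_eq_square algebra_simps)
      moreover have "0 \<le> (A - B)^2 + (B - C)^2 + (A - C)^2" for A B C :: real by simp
      ultimately show ?thesis by (metis diff_ge_0_iff_ge)
    qed
    also have "\<dots> = 3 * M^2 * (1 + x^2 + \<epsilon>^2 * x^4)"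
      by (simp add: power_mult_distrib algebra_simps flip: power_mult)
    finally have *: "(norm (z0 + z1 * of_real x + z2 * (of_real x)^2))^2 \<le> 3 * M^2 * (1 + x^2 + \<epsilon>^2 * x^4)" .
    have "(norm ((z0 + z1 * of_real x + z2 * (of_real x)^2) * exp (\<beta> * of_real x)))^2 =
        (norm (z0 + z1 * of_real x + z2 * (of_real x)^2))^2 * exp (- (2 * \<epsilon>) * x)"
      using \<beta> by (simp add: norm_mult power_mult_distrib exp_double[symmetric] mult_ac)
    also have "\<dots> \<le> 3 * M^2 * (1 + x^2 + \<epsilon>^2 * x^4) * exp (- (2 * \<epsilon>) * x)"
      by (intro mult_right_mono *) simp
    also have "\<dots> = 3 * M^2 * (?v 0 x + ?v 2 x + \<epsilon>^2 * ?v 4 x)"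
      by (simp add: algebra_simps)
    finally show "(norm ((z0 + z1 * of_real x + z2 * (of_real x)^2) * exp (\<beta> * of_real x)))^2 \<le>
        3 * M^2 * (?v 0 x + ?v 2 x + \<epsilon>^2 * ?v 4 x)" .
  qed
  also have "\<dots> = 3 * M^2 * (fact 0 / (2 * \<epsilon>) ^ Suc 0 + fact 2 / (2 * \<epsilon>) ^ Suc 2 + \<epsilon>^2 * (fact 4 / (2 * \<epsilon>) ^ Suc 4))"
    unfolding set_integral_mult_right
      set_integral_add(2)[OF set_integral_add(1)[OF vi vi] set_integrable_mult_right[OF vi]]
      set_integral_add(2)[OF vi vi] vv ..
  also have "fact 0 / (2 * \<epsilon>) ^ Suc 0 + fact 2 / (2 * \<epsilon>) ^ Suc 2 + \<epsilon>^2 * (fact 4 / (2 * \<epsilon>) ^ Suc 4) =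
      (\<epsilon>^2 / 2 + 1) / \<epsilon>^3"
    using \<epsilon>(1) by (simp add: fact_numeral eval_nat_numeral field_simps)
  also have "3 * M^2 * ((\<epsilon>^2 / 2 + 1) / \<epsilon>^3) \<le> 3 * M^2 * (2 / \<epsilon>^3)"
  proof (intro mult_left_mono divide_right_mono)
    have "\<epsilon>^2 \<le> 1" using \<epsilon> by (simp add: power_le_one)
    then show "\<epsilon>^2 / 2 + 1 \<le> 2" by simp
  qed (use \<epsilon> in auto)
  finally show ?thesis by simp
qed

text \<open>The functions \<open>x\<^sup>2 exp ((\<i>\<xi> - \<epsilon>) x)\<close> on the first branch, extended by zero, form a Weyl
  sequence as \<open>\<epsilon> \<rightarrow> 0\<close>: the factor \<open>x\<^sup>2\<close> makes them vanish to first order at the vertex, and their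
  squared norms grow like \<open>\<epsilon>\<^sup>-\<^sup>5\<close>, those of their images under \<open>\<lambda> - A\<close> like \<open>\<epsilon>\<^sup>-\<^sup>3\<close>.\<close>
lemma real_not_in_resolvent_set:
  assumes n: "n \<ge> 1" and c: "c 1 > 0" and l: "a 1 \<le> l"
  shows "of_real l \<notin> resolvent_set n c a"
proof
  assume "of_real l \<in> resolvent_set n c a"
  then obtain C where C: "\<And>f u. inH n f \<Longrightarrow> resolvent_eq n c a (of_real l) u f \<Longrightarrow> normH n u \<le> C * normH n f"
    unfolding resolvent_set_def mem_Collect_eq by blast
  define \<xi> where "\<xi> = sqrt ((l - a 1) / c 1)"
  have \<xi>: "\<xi> \<ge> 0" "c 1 * \<xi>^2 = l - a 1" using l c by (auto simp: \<xi>_def)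
  \<comment> \<open>A common bound for the coefficients of f, namely 2c and 4c\<beta>, and for the
    third one, c \<open>z2\<close>, after division by \<epsilon>; the factor 1 + 2\<xi> bounds both
    |\<beta>| and |\<open>z2\<close>|/\<epsilon>.\<close>
  define M where "M = c 1 * 4 * (1 + 2 * \<xi>)"
  have M0: "M \<ge> 0" using c \<xi> by (simp add: M_def)
  define K where "K = C^2 * 6 * M^2"
  \<comment> \<open>A single member of the Weyl family is enough. The resolvent bound will give 3/4
    \<le> K \<epsilon>^2 \<le> K \<epsilon>, whereas this \<epsilon> makes K \<epsilon> at most
    1/2.\<close>
  define \<epsilon> where "\<epsilon> = 1 / (1 + 2 * K)"
  have K: "K \<ge> 0" by (simp add: K_def)
  have \<epsilon>: "0 < \<epsilon>" "\<epsilon> \<le> 1" using K by (auto simp: \<epsilon>_def)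
  define \<beta> where "\<beta> = \<i> * of_real \<xi> - of_real \<epsilon>"
  have \<beta>: "Re \<beta> = - \<epsilon>" by (simp add: \<beta>_def)
  then have \<beta>n: "Re \<beta> < 0" using \<epsilon> by simp
  have n\<beta>: "norm \<beta> \<le> 1 + 2 * \<xi>"
  proof -
    have "norm \<beta> \<le> norm (\<i> * of_real \<xi>) + norm (complex_of_real \<epsilon>)"
      unfolding \<beta>_def by (rule norm_triangle_ineq4)
    then show ?thesis using \<xi> \<epsilon> by (simp add: norm_mult)
  qed
  define G where "G p q r x = (p + q * of_real x + r * (of_real x)^2) * exp (\<beta> * of_real x)" for p q r and x :: real
  \<comment> \<open>This is \<beta>^2 + \<xi>^2. Since \<beta> differs from \<i>\<xi> by \<epsilon>,
    the terms of order zero cancel and the factor \<epsilon> required by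
    \<open>quad_exp_norm_bound\<close> appears.\<close>
  define z2 where "z2 = of_real \<epsilon> * (of_real \<epsilon> - 2 * \<i> * of_real \<xi>)"
  have z2: "of_real (c 1) * z2 = of_real (l - a 1) + of_real (c 1) * \<beta>^2"
  proof -
    have "z2 = \<beta>^2 + of_real (\<xi>^2)"
      by (simp add: \<beta>_def z2_def power2_eq_square algebra_simps)
    then show ?thesis
      unfolding \<xi>(2)[symmetric] by (simp add: algebra_simps)
  qed
  define u where "u k = (if k = 1 then G 0 0 1 else (\<lambda>x. 0))" for k :: nat
  define d where "d k = (if k = 1 then G 0 2 \<beta> else (\<lambda>x. 0))" for k :: nat
  define e where "e k = (if k = 1 then G 2 (4 * \<beta>) (\<beta>^2) else (\<lambda>x. 0))" for k :: nat
  define f where "f k = (if k = 1 then G (of_real (c 1) * 2) (of_real (c 1) * (4 * \<beta>)) (of_real (c 1) * z2) else (\<lambda>x. 0))" for k :: nat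
  have L2G: "L2 (G p q r)" for p q r
    unfolding G_def [abs_def] using \<beta>n by (rule L2_quad_exp)
  have L20: "L2 (\<lambda>x. 0)" using L2_cmult[OF L2G, of 0] by simp
  have cG: "continuous_on S (G p q r)" for p q r S
    unfolding G_def [abs_def] by (intro continuous_intros)
  have dG: "(G p q r has_vector_derivative G (q + p * \<beta>) (2 * r + q * \<beta>) (r * \<beta>) x) (at x)" for p q r x
    unfolding G_def [abs_def] by (rule quad_exp_has_derivative)
  have wG: "is_weak_deriv (G p q r) (G (q + p * \<beta>) (2 * r + q * \<beta>) (r * \<beta>))" for p q r
    by (rule is_weak_deriv_classical[OF dG cG])
  have w0: "is_weak_deriv (\<lambda>x. 0) (\<lambda>x. 0)" by (simp add: is_weak_deriv_def)
  have w1: "is_weak_deriv (G 0 0 1) (G 0 2 \<beta>)" using wG[of 0 0 1] by simp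
  have w2: "is_weak_deriv (G 0 2 \<beta>) (G 2 (4 * \<beta>) (\<beta>^2))"
    using wG[of 0 2 \<beta>] by (simp add: power2_eq_square)
  have "inH n f" by (simp add: inH_def f_def L2G L20)
  moreover have "resolvent_eq n c a (of_real l) u f"
    unfolding resolvent_eq_def
  proof (rule exI[of _ d], rule exI[of _ e], intro conjI ballI)
    fix k
    show "L2 (u k)" "L2 (d k)" "L2 (e k)" by (simp_all add: u_def d_def e_def L2G L20)
    show "continuous_on {0..} (u k)" "continuous_on {0..} (d k)" by (simp_all add: u_def d_def cG)
    show "is_weak_deriv (u k) (d k)" "is_weak_deriv (d k) (e k)"
      by (simp_all add: u_def d_def e_def w0 w1 w2)
    have "of_real l * u k x - (- of_real (c k) * e k x + of_real (a k) * u k x) = f k x" for x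
    proof (cases "k = 1")
      case True
      have "of_real l * G 0 0 1 x - (- of_real (c 1) * G 2 (4 * \<beta>) (\<beta>^2) x + of_real (a 1) * G 0 0 1 x) =
        G (of_real (c 1) * 2) (of_real (c 1) * (4 * \<beta>)) (of_real (l - a 1) + of_real (c 1) * \<beta>^2) x"
        by (simp add: G_def algebra_simps)
      then show ?thesis
        unfolding z2[symmetric] True by (simp add: u_def e_def f_def)
    qed (simp add: u_def e_def f_def)
    then show "AE x in lborel. x > 0 \<longrightarrow> of_real l * u k x - (- of_real (c k) * e k x + of_real (a k) * u k x) = f k x"
      by simp
  next
    show "u i 0 = u k 0" for i k by (simp add: u_def G_def)
    show "(\<Sum>k = 1..n. of_real (c k) * d k 0) = 0" by (intro sum.neutral) (simp add: d_def G_def)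
  qed
  ultimately have *: "normH n u \<le> C * normH n f" by (rule C)
  have single: "(\<Sum>k = 1..n. LINT x:{0<..}|lborel. (norm (if k = 1 then v x else 0))^2) =
     (LINT x:{0<..}|lborel. (norm (v x))^2)" for v :: "real \<Rightarrow> complex"
  proof -
    have "(\<Sum>k = 1..n. LINT x:{0<..}|lborel. (norm (if k = 1 then v x else 0))^2) =
      (\<Sum>k = 1..n. if k = 1 then LINT x:{0<..}|lborel. (norm (v x))^2 else 0)"
      by (intro sum.cong) auto
    then show ?thesis using n by simp
  qed
  have nu: "(normH n u)^2 = 3 / (4 * \<epsilon>^5)"
  proof -
    have "(normH n u)^2 = (LINT x:{0<..}|lborel. (norm (G 0 0 1 x))^2)"
    proof -
      have "(\<Sum>k = 1..n. LINT x:{0<..}|lborel. (norm (u k x))^2) = (LINT x:{0<..}|lborel. (norm (G 0 0 1 x))^2)"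
        using single[of "G 0 0 1"] by (simp add: u_def if_distrib[of "\<lambda>h. h _"] cong: if_cong)
      moreover have "0 \<le> (LINT x:{0<..}|lborel. (norm (G 0 0 1 x))^2)"
        by (simp add: set_lebesgue_integral_def)
      ultimately show ?thesis by (simp add: normH_def)
    qed
    also have "(\<lambda>x. (norm (G 0 0 1 x))^2) = (\<lambda>x. x^4 * exp (- (2 * \<epsilon>) * x))"
    proof
      fix x
      show "(norm (G 0 0 1 x))^2 = x^4 * exp (- (2 * \<epsilon>) * x)"
        using \<beta> by (simp add: G_def norm_mult norm_power power_mult_distrib exp_double[symmetric] mult_ac flip: power_mult)
    qed
    also have "(LINT x:{0<..}|lborel. x^4 * exp (- (2 * \<epsilon>) * x)) = fact 4 / (2 * \<epsilon>)^Suc 4"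
      using \<epsilon> by (intro set_integral_power_exp(2)) auto
    also have "\<dots> = 3 / (4 * \<epsilon>^5)"
      by (simp add: fact_numeral power_mult_distrib)
    finally show ?thesis .
  qed
  have nf: "(normH n f)^2 \<le> 6 * M^2 / \<epsilon>^3"
  proof -
    let ?G = "G (of_real (c 1) * 2) (of_real (c 1) * (4 * \<beta>)) (of_real (c 1) * z2)"
    have "(\<Sum>k = 1..n. LINT x:{0<..}|lborel. (norm (f k x))^2) = (LINT x:{0<..}|lborel. (norm (?G x))^2)"
      using single[of ?G] by (simp add: f_def if_distrib[of "\<lambda>h. h _"] cong: if_cong)
    moreover have "0 \<le> (LINT x:{0<..}|lborel. (norm (?G x))^2)"
      by (simp add: set_lebesgue_integral_def)
    ultimately have "(normH n f)^2 = (LINT x:{0<..}|lborel. (norm (?G x))^2)" by (simp add: normH_def)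
    also have "\<dots> \<le> 6 * M^2 / \<epsilon>^3"
      unfolding G_def
    proof (rule quad_exp_norm_bound[OF \<epsilon> \<beta> M0])
      show "norm (of_real (c 1) * 2 :: complex) \<le> M"
        using c \<xi> by (simp add: M_def norm_mult algebra_simps)
      show "norm (of_real (c 1) * (4 * \<beta>)) \<le> M"
        using c n\<beta> by (simp add: M_def norm_mult)
      have "norm (complex_of_real \<epsilon> - 2 * \<i> * of_real \<xi>) \<le> norm (complex_of_real \<epsilon>) + norm (2 * \<i> * complex_of_real \<xi>)"
        by (rule norm_triangle_ineq4)
      also have "\<dots> \<le> 4 * (1 + 2 * \<xi>)" using \<epsilon> \<xi> by (simp add: norm_mult)
      finally have "norm z2 \<le> \<epsilon> * (4 * (1 + 2 * \<xi>))"
        unfolding z2_def norm_mult using \<epsilon> by (intro mult_mono) auto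
      then have "c 1 * norm z2 \<le> c 1 * (\<epsilon> * (4 * (1 + 2 * \<xi>)))"
        using c by (intro mult_left_mono) auto
      then show "norm (of_real (c 1) * z2) \<le> M * \<epsilon>"
        using c by (simp add: M_def norm_mult mult_ac)
    qed
    finally show ?thesis .
  qed
  have "0 \<le> normH n u" by (auto simp: normH_def set_lebesgue_integral_def intro!: sum_nonneg)
  with * have "(normH n u)^2 \<le> (C * normH n f)^2" by (intro power_mono)
  also have "\<dots> \<le> C^2 * (6 * M^2 / \<epsilon>^3)"
    unfolding power_mult_distrib using nf by (intro mult_left_mono) auto
  finally have "3 / (4 * \<epsilon>^5) \<le> K / \<epsilon>^3" unfolding nu by (simp add: K_def)
  then have "3 / (4 * \<epsilon>^5) * \<epsilon>^5 \<le> K / \<epsilon>^3 * \<epsilon>^5"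
    using \<epsilon> by (intro mult_right_mono) auto
  also have "K / \<epsilon>^3 * \<epsilon>^5 = K * \<epsilon>^2"
    using \<epsilon> by (simp add: field_simps eval_nat_numeral)
  also have "\<dots> \<le> K * \<epsilon>"
    using \<epsilon> K by (intro mult_left_mono) (auto simp: power2_eq_square mult_left_le)
  also have "\<dots> \<le> 1 / 2" using K by (simp add: \<epsilon>_def field_simps)
  finally show False using \<epsilon> by simp
qed

section \<open>The resolvent kernel\<close>

lemma psqrt_squared: "psqrt z ^ 2 = z"
proof -
  have "psqrt z ^ 2 = of_real (sqrt (cmod z))^2 * exp (\<i> * of_real (if Arg z = pi then - pi else Arg z))"
    unfolding psqrt_def power_mult_distrib exp_double[symmetric] by simp
  \<comment> \<open>Moving the argument from \<pi> to -\<pi> is invisible after squaring, as the two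
    differ by a full turn.\<close>
  also have "exp (\<i> * of_real (if Arg z = pi then - pi else Arg z)) = cis (Arg z)"
    by (simp add: cis_conv_exp[symmetric]) (simp add: complex_eq_iff)
  also have "of_real (sqrt (cmod z))^2 = of_real (cmod z)"
    by (metis norm_ge_zero of_real_power real_sqrt_pow2)
  finally show ?thesis using rcis_cmod_Arg[of z] by (simp add: rcis_def)
qed

lemma Re_psqrt_nonneg: "0 \<le> Re (psqrt z)"
proof -
  have "0 \<le> cos ((if Arg z = pi then - pi else Arg z) / 2)"
    using Arg_bounded[of z] by (intro cos_ge_zero) auto
  then show ?thesis by (simp add: psqrt_def Re_exp)
qed

text \<open>Taking imaginary parts in z = (psqrt z)^2 gives Im z = 2 Re(psqrt z) Im(psqrt z), and
  the chosen branch has nonnegative real part; a nonzero left side therefore fixes the sign of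
  Im(psqrt z).\<close>

lemma Im_psqrt:
  shows "Im z > 0 \<Longrightarrow> Im (psqrt z) > 0" and "Im z < 0 \<Longrightarrow> Im (psqrt z) < 0"
proof -
  have "Im z = 2 * Re (psqrt z) * Im (psqrt z)"
    using arg_cong[OF psqrt_squared[of z], of Im] by (simp add: power2_eq_square mult_ac)
  then show "Im z > 0 \<Longrightarrow> Im (psqrt z) > 0" "Im z < 0 \<Longrightarrow> Im (psqrt z) < 0"
    using Re_psqrt_nonneg[of z] by (auto simp: zero_less_mult_iff mult_less_0_iff)
qed

text \<open>The exponent of the decaying exponential on branch k when \<lambda> is not real. It
  absorbs the sign convention, so that both half-planes are handled by one computation.\<close>

definition kap :: "(nat \<Rightarrow> real) \<Rightarrow> (nat \<Rightarrow> real) \<Rightarrow> complex \<Rightarrow> nat \<Rightarrow> complex" where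
  "kap c a lam k = sgn_lam lam * \<i> * xi c a k lam"

lemma sgn_lam_squared: "(sgn_lam lam)^2 = 1"
  by (simp add: sgn_lam_def)

lemma kap_squared:
  assumes "c k > 0"
  shows "of_real (c k) * (kap c a lam k)^2 = of_real (a k) - lam"
proof -
  have "(kap c a lam k)^2 = - ((xi c a k lam)^2)"
    by (simp add: kap_def power_mult_distrib sgn_lam_squared)
  then show ?thesis using assms by (simp add: xi_def psqrt_squared)
qed

lemma Re_kap_neg:
  assumes "c k > 0" "Im lam \<noteq> 0"
  shows "Re (kap c a lam k) < 0"
proof -
  let ?z = "(lam - of_real (a k)) / of_real (c k)"
  have "Im ?z = Im lam / c k" by (simp add: Im_divide_of_real)
  then show ?thesis
    using assms Im_psqrt[of ?z] by (auto simp: kap_def xi_def sgn_lam_def divide_pos_pos divide_neg_pos linorder_neq_iff)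
qed

text \<open>Euler's formula separates the decaying from the growing exponential, which makes
  \<open>lagrange\<close> applicable to each of them.\<close>

lemma F_fun_same:
  "F_fun n c a j lam j t =
    (1 + s_fun n c a j lam) / 2 * exp (kap c a lam j * of_real t) +
    (1 - s_fun n c a j lam) / 2 * exp (- kap c a lam j * of_real t)"
proof -
  let ?z = "xi c a j lam * of_real t"
  have "exp (sgn_lam lam * \<i> * ?z) = cos ?z + sgn_lam lam * \<i> * sin ?z"
    "exp (- sgn_lam lam * \<i> * ?z) = cos ?z - sgn_lam lam * \<i> * sin ?z"
    using exp_Euler[of ?z] exp_Euler[of "- ?z"] by (auto simp: sgn_lam_def)
  then show ?thesis by (simp add: F_fun_def kap_def mult.assoc) (simp add: field_simps)
qed

lemma F_fun_other: "k \<noteq> j \<Longrightarrow> F_fun n c a j lam k t = exp (kap c a lam k * of_real t)"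
  by (simp add: F_fun_def kap_def)

lemma w_fun_kap: "w_fun n c a lam = (\<Sum>k=1..n. of_real (c k) * kap c a lam k)"
  by (simp add: w_fun_def kap_def sum_distrib_left mult_ac)

text \<open>Combined with \<open>w_fun_kap\<close> this gives c_j \<kappa>_j (1 - s_j) = w for j in
  {1..n}, the normalisation on which the last step of the computation rests.\<close>

lemma s_fun_kap:
  assumes "c j > 0" "kap c a lam j \<noteq> 0"
  shows "of_real (c j) * kap c a lam j * s_fun n c a j lam = - (\<Sum>l\<in>{1..n}-{j}. of_real (c l) * kap c a lam l)"
proof -
  have "xi c a j lam \<noteq> 0" using assms(2) by (auto simp: kap_def)
  then have "of_real (c j) * kap c a lam j * s_fun n c a j lam =
      - (sgn_lam lam * \<i> * (\<Sum>l\<in>{1..n}-{j}. of_real (c l) * xi c a l lam))"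
    using assms(1) by (simp add: s_fun_def kap_def)
  then show ?thesis by (simp add: kap_def sum_distrib_left mult_ac)
qed

text \<open>A and B stand for the two coefficients in \<open>F_fun_same\<close>. The interval is
  bounded, so local integrability is enough for the growing exponential, and \<open>lagrange\<close>
  is used with both roots.\<close>

lemma (in branch_solution) integral_up_to:
  assumes \<kappa>: "of_real c * \<kappa>^2 = of_real a - lam" and t: "0 \<le> t"
  shows "set_integrable lborel {0<..t} (\<lambda>x. (A * exp (\<kappa> * of_real x) + B * exp (- \<kappa> * of_real x)) * f x)"
    and "(LINT x:{0<..t}|lborel. (A * exp (\<kappa> * of_real x) + B * exp (- \<kappa> * of_real x)) * f x) =
      of_real c * (A * exp (\<kappa> * of_real t) * (d t - \<kappa> * u t) + B * exp (- \<kappa> * of_real t) * (d t + \<kappa> * u t)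
        - A * (d 0 - \<kappa> * u 0) - B * (d 0 + \<kappa> * u 0))"
proof -
  have "loc_int (\<lambda>x. exp (\<mu> * of_real x) * f x)" for \<mu>
    by (intro loc_int_mult_continuous L2_loc_int L2 continuous_intros)
  then have i: "set_integrable lborel {0<..t} (\<lambda>x. z * (exp (\<mu> * of_real x) * f x))" for \<mu> z
    by (simp add: loc_int_def)
  have eq: "(A * exp (\<kappa> * of_real x) + B * exp (- \<kappa> * of_real x)) * f x =
      A * (exp (\<kappa> * of_real x) * f x) + B * (exp (- \<kappa> * of_real x) * f x)" for x
    by (simp only: distrib_right mult.assoc)
  show "set_integrable lborel {0<..t} (\<lambda>x. (A * exp (\<kappa> * of_real x) + B * exp (- \<kappa> * of_real x)) * f x)"
    unfolding eq by (intro set_integral_add(1) i)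
  have m: "of_real c * (- \<kappa>)^2 = of_real a - lam" using \<kappa> by simp
  show "(LINT x:{0<..t}|lborel. (A * exp (\<kappa> * of_real x) + B * exp (- \<kappa> * of_real x)) * f x) =
      of_real c * (A * exp (\<kappa> * of_real t) * (d t - \<kappa> * u t) + B * exp (- \<kappa> * of_real t) * (d t + \<kappa> * u t)
        - A * (d 0 - \<kappa> * u 0) - B * (d 0 + \<kappa> * u 0))"
    unfolding eq set_integral_add(2)[OF i i] set_integral_mult_right lagrange[OF \<kappa> order_refl t] lagrange[OF m order_refl t]
    by (simp add: algebra_simps)
qed

section \<open>Evaluation of the kernel integral at a fixed point\<close>

theorem theorem3p8:
  fixes n :: nat and c a :: "nat \<Rightarrow> real" and lam :: complex
    and f u :: "nat \<Rightarrow> real \<Rightarrow> complex"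
  assumes n2: "n \<ge> 2"
    and cpos: "\<forall>k\<in>{1..n}. c k > 0"
    and a1: "0 \<le> a 1"
    and amono: "\<forall>i j. 1 \<le> i \<and> i \<le> j \<and> j \<le> n \<longrightarrow> a i \<le> a j"
    and fH: "inH n f"
    and lam_rho: "lam \<in> resolvent_set n c a"
    and lam_re: "Re lam \<ge> a 1"
    and u_res: "resolvent_eq n c a lam u f"
  shows "\<forall>j\<in>{1..n}. \<forall>t\<ge>0.
           (\<forall>k\<in>{1..n}. set_integrable lborel {0<..} (\<lambda>t'. K_fun n c a j t k t' lam * f k t'))
         \<and> u j t = (\<Sum>k=1..n. LINT t':{0<..}|lborel. K_fun n c a j t k t' lam * f k t')"
proof (intro ballI allI impI conjI)
  have lam_im: "Im lam \<noteq> 0"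
  proof
    assume "Im lam = 0"
    then have "lam = of_real (Re lam)" by (simp add: complex_eq_iff)
    then show False
      using real_not_in_resolvent_set[of n c a "Re lam"] n2 cpos lam_re lam_rho by auto
  qed
  obtain d e where de: "\<forall>k\<in>{1..n}. L2 (u k) \<and> continuous_on {0..} (u k)
               \<and> L2 (d k) \<and> continuous_on {0..} (d k) \<and> is_weak_deriv (u k) (d k)
               \<and> L2 (e k) \<and> is_weak_deriv (d k) (e k)
               \<and> (AE x in lborel. x > 0 \<longrightarrow>
                    lam * u k x - (- of_real (c k) * e k x + of_real (a k) * u k x) = f k x)"
    and vertex: "\<forall>i\<in>{1..n}. \<forall>k\<in>{1..n}. u i 0 = u k 0"
    and kirchhoff: "(\<Sum>k=1..n. of_real (c k) * d k 0) = 0"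
    using u_res unfolding resolvent_eq_def by (elim exE conjE) (rule that)
  have br: "branch_solution (c k) (a k) lam (u k) (d k) (e k) (f k)" if "k \<in> {1..n}" for k
    using bspec[OF de that] fH that by (simp add: branch_solution_def inH_def)
  fix j t assume j: "j \<in> {1..n}" and t: "(0::real) \<le> t"
  define \<kappa> where "\<kappa> k = kap c a lam k" for k
  have \<kappa>: "of_real (c k) * (\<kappa> k)^2 = of_real (a k) - lam" "Re (\<kappa> k) < 0" if "k \<in> {1..n}" for k
    using that cpos lam_im kap_squared Re_kap_neg by (auto simp: \<kappa>_def)
  define E where "E = exp (\<kappa> j * of_real t)"
  define w s where "w = w_fun n c a lam" and "s = s_fun n c a j lam"
  define F where "F x = (1 + s) / 2 * exp (\<kappa> j * of_real x) + (1 - s) / 2 * exp (- \<kappa> j * of_real x)" for x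
  have E0: "E \<noteq> 0" and Einv: "exp (- \<kappa> j * of_real t) = 1 / E"
    by (simp_all add: E_def exp_minus field_simps)
  have w: "w = of_real (c j) * \<kappa> j + (\<Sum>k\<in>{1..n}-{j}. of_real (c k) * \<kappa> k)"
    unfolding w_def w_fun_kap \<kappa>_def using j by (subst sum.remove[of _ j]) auto
  have w0: "w \<noteq> 0"
  proof -
    have "Re w = (\<Sum>k=1..n. c k * Re (\<kappa> k))" by (simp add: w_def w_fun_kap \<kappa>_def)
    also have "\<dots> < 0"
      using n2 cpos \<kappa>(2) sum_strict_mono[of "{1..n}" "\<lambda>k. c k * Re (\<kappa> k)" "\<lambda>k. 0"]
      by (auto simp: mult_pos_neg)
    finally show ?thesis by auto
  qed
  have s: "of_real (c j) * \<kappa> j * s = - (\<Sum>k\<in>{1..n}-{j}. of_real (c k) * \<kappa> k)"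
  proof -
    have "kap c a lam j \<noteq> 0" using \<kappa>(2)[OF j] by (auto simp: \<kappa>_def)
    then show ?thesis unfolding s_def \<kappa>_def using j cpos by (intro s_fun_kap) auto
  qed
  \<comment> \<open>This is where n \<ge> 2 enters: on branch j the function F^(j+1) is then the
    pure exponential, with value \<open>E\<close> at t.\<close>
  have nxt: "nxt n j \<noteq> j" using n2 j by (auto simp: nxt_def)
  note j_up = branch_solution.integral_up_to[OF br[OF j] \<kappa>(1)[OF j] t, where A = "(1 + s) / 2" and B = "(1 - s) / 2", folded F_def]
  note j_top = branch_solution.lagrange_at_top[OF br[OF j] \<kappa>[OF j] t]
  let ?I = "\<lambda>k. LINT t':{0<..}|lborel. K_fun n c a j t k t' lam * f k t'"
  have Kj: "K_fun n c a j t j x lam * f j x =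
      (if x > t then F t / w * (exp (\<kappa> j * of_real x) * f j x) else E / w * (F x * f j x))" for x
    using nxt by (simp add: K_fun_def F_fun_same F_fun_other F_def E_def \<kappa>_def s_def w_def)
  \<comment> \<open>On a foreign branch k the variable x' occurs only in F^j, which is a pure
    exponential on every k \<noteq> j; the case k = j + 1 needs no special treatment.\<close>
  have Kk: "K_fun n c a j t k x lam * f k x = E / w * (exp (\<kappa> k * of_real x) * f k x)" if "k \<noteq> j" for k x
    using nxt that by (simp add: K_fun_def F_fun_other E_def \<kappa>_def w_def)
  have "set_integrable lborel {0<..t} (\<lambda>x. E / w * (F x * f j x))"
    "set_integrable lborel {t<..} (\<lambda>x. F t / w * (exp (\<kappa> j * of_real x) * f j x))"
    by (intro set_integrable_mult_right j_up(1) j_top(1))+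
  note j_split = set_integral_if_gt[OF t this]
  have Ij: "?I j = F t / w * (- of_real (c j) * (E * (d j t - \<kappa> j * u j t))) +
      E / w * (of_real (c j) * ((1 + s) / 2 * E * (d j t - \<kappa> j * u j t) + (1 - s) / 2 * (1 / E) * (d j t + \<kappa> j * u j t)
        - (1 + s) / 2 * (d j 0 - \<kappa> j * u j 0) - (1 - s) / 2 * (d j 0 + \<kappa> j * u j 0)))"
    unfolding Kj j_split(2) set_integral_mult_right j_up(2) j_top(2) Einv E_def[symmetric] by simp
  have Ik: "set_integrable lborel {0<..} (\<lambda>t'. K_fun n c a j t k t' lam * f k t')"
    "?I k = E / w * (- of_real (c k) * (d k 0 - \<kappa> k * u j 0))" if k: "k \<in> {1..n}" "k \<noteq> j" for k
    using branch_solution.lagrange_at_top[OF br[OF k(1)] \<kappa>[OF k(1)] order_refl] vertex[rule_format, OF k(1) j]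
    unfolding Kk[OF k(2)] by simp_all
  show "set_integrable lborel {0<..} (\<lambda>t'. K_fun n c a j t k t' lam * f k t')" if "k \<in> {1..n}" for k
    using j_split(1) Ik(1)[OF that] unfolding Kj[symmetric] by (cases "k = j") auto
  have "(\<Sum>k=1..n. ?I k) = ?I j + (\<Sum>k\<in>{1..n}-{j}. ?I k)"
    using j by (intro sum.remove) auto
  also have "(\<Sum>k\<in>{1..n}-{j}. ?I k) = (\<Sum>k\<in>{1..n}-{j}. E / w * (- of_real (c k) * (d k 0 - \<kappa> k * u j 0)))"
    using Ik(2) by (intro sum.cong) auto
  also have "\<dots> = E / w * (u j 0 * (\<Sum>k\<in>{1..n}-{j}. of_real (c k) * \<kappa> k) - (\<Sum>k\<in>{1..n}-{j}. of_real (c k) * d k 0))"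
    unfolding sum_distrib_left sum_subtractf[symmetric] by (intro sum.cong) (simp_all add: algebra_simps)
  \<comment> \<open>The Kirchhoff condition here and the value of s in the next step turn the sums
    over the other branches into data of branch j alone.\<close>
  also have "(\<Sum>k\<in>{1..n}-{j}. of_real (c k) * d k 0) = - of_real (c j) * d j 0"
    using kirchhoff sum.remove[of "{1..n}" j "\<lambda>k. of_real (c k) * d k 0"] j by (simp add: add_eq_0_iff)
  also have "(\<Sum>k\<in>{1..n}-{j}. of_real (c k) * \<kappa> k) = - (of_real (c j) * \<kappa> j * s)"
    using s by simp
  finally have sum_I: "(\<Sum>k=1..n. ?I k) = ?I j + E / w * (u j 0 * - (of_real (c j) * \<kappa> j * s) - - of_real (c j) * d j 0)" .
  have cancel_w: "w * (X / w * Y + Z / w * V) = X * Y + Z * V" for X Y Z V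
    using w0 by (simp add: distrib_left)
  have "w * (\<Sum>k=1..n. ?I k) = w * ?I j + E * (- (u j 0 * (of_real (c j) * \<kappa> j * s)) + of_real (c j) * d j 0)"
    unfolding sum_I using w0 by (simp add: distrib_left)
  also have "\<dots> = F t * (- of_real (c j) * (E * (d j t - \<kappa> j * u j t))) +
      E * (of_real (c j) * ((1 + s) / 2 * E * (d j t - \<kappa> j * u j t) + (1 - s) / 2 * (1 / E) * (d j t + \<kappa> j * u j t)
        - (1 + s) / 2 * (d j 0 - \<kappa> j * u j 0) - (1 - s) / 2 * (d j 0 + \<kappa> j * u j 0))) +
      E * (- (u j 0 * (of_real (c j) * \<kappa> j * s)) + of_real (c j) * d j 0)"
    unfolding Ij cancel_w ..
  \<comment> \<open>The terms with \<open>E^2\<close> cancel, and so do all vertex terms. In the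
    remaining part, with coefficient c_j (1 - s)/2, the difference of u' + \<kappa>u and u' -
    \<kappa>u at t leaves 2\<kappa>u.\<close>
  also have "\<dots> = (of_real (c j) * \<kappa> j - of_real (c j) * \<kappa> j * s) * u j t"
    unfolding F_def Einv E_def[symmetric] using E0 by (simp add: field_simps)
  also have "\<dots> = w * u j t"
    unfolding s w by simp
  finally show "u j t = (\<Sum>k=1..n. ?I k)" using w0 by simp
qed

end
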